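(* Let $n\ge 2$. The type D odd Demazure operators $\partial_1^-,\dots,\partial_{n-1}^-,\partial_n^{D}$ on the skew-polynomial algebra $\mathrm{Pol}_n^-$, together with the operators of left multiplication by $x_1,\dots,x_n$, define a representation of the spin type D nilHecke algebra ${}^{D}\mathrm{NH}_n^-$ on $\mathrm{Pol}_n^-$ (the generators $x_i$, $\partial_i^-$, $\partial_n^D$ acting by the operators of the same name).
   Context: $\mathrm{Pol}_n^-$ is the unital $\mathbb{Z}$-algebra generated by $x_1,\dots,x_n$ subject to $x_ix_j+x_jx_i=0$ for all $i\ne j$. The spin type D nilHecke algebra ${}^{D}\mathrm{NH}_n^-$ is the unital $\mathbb{Z}$-algebra generated by $x_1,\dots,x_n$, $\partial_1^-,\dots,\partial_{n-1}^-$, $\partial_n^D$ subject to $x_ix_j+x_jx_i=0$ ($i\neq j$) and, for $1\le i\le n-1$ (whenever the indices make sense): $(\partial_i^-)^2=0$; $\partial_i^-\partial_{i+1}^-\partial_i^-=\partial_{i+1}^-\partial_i^-\partial_{i+1}^-$; $\partial_i^-\partial_j^-+\partial_j^-\partial_i^-=0$ for $|i-j|>1$; $x_i\partial_i^-+\partial_i^-x_{i+1}=1$; $\partial_i^-x_i+x_{i+1}\partial_i^-=1$; $\partial_i^-x_j+x_j\partial_i^-=0$ for $j\ne i,i+1$; and $(\partial_n^D)^2=0$; $\partial_n^D\partial_{n-2}^-\partial_n^D=\partial_{n-2}^-\partial_n^D\partial_{n-2}^-$; $\partial_n^D\partial_i^-+\partial_i^-\partial_n^D=0$ for $1\le i\le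 n-3$; $\partial_n^D\partial_{n-1}^--\partial_{n-1}^-\partial_n^D=0$; $x_{n-1}\partial_n^D-\partial_n^Dx_n=1$; $\partial_n^Dx_{n-1}-x_n\partial_n^D=1$; $\partial_n^Dx_i+x_i\partial_n^D=0$ for $1\le i\le n-2$. Odd Demazure operators. For $1\le i\le n-1$ let $s_i$ be the algebra endomorphism of $\mathrm{Pol}_n^-$ with $s_i(x_i)=-x_{i+1}$, $s_i(x_{i+1})=-x_i$, $s_i(x_j)=-x_j$ for $j\ne i,i+1$, and let $s_n^D$ be the algebra endomorphism with $s_n^D(x_n)=x_{n-1}$, $s_n^D(x_{n-1})=x_n$, $s_n^D(x_j)=-x_j$ for $j\le n-2$. The type D odd Demazure operators are the $\mathbb{Z}$-linear operators $\partial_i^-$ ($1\le i\le n-1$) and $\partial_n^D$ on $\mathrm{Pol}_n^-$ that kill $1$ and satisfy: $\partial_i^-(x_j)=1$ if $j\in\{i,i+1\}$ and $0$ otherwise; $\partial_n^D(x_n)=-1$, $\partial_n^D(x_{n-1})=1$, $\partial_n^D(x_j)=0$ for $j\le n-2$; and, for all $f,g\in\mathrm{Pol}_n^-$, $\partial_i^-(fg)=\partial_i^-(f)g+s_i(f)\partial_i^-(g)$ and $\partial_n^D(fg)=\partial_n^D(f)g+s_n^D(f)\partial_n^D(g)$. *)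

theory Defs
  imports "HOL-Algebra.QuotRing" "HOL-Library.Poly_Mapping" "HOL-Library.FuncSet"
begin

section \<open>Unital rings presented by generators and relations\<close>

text \<open>
  Words form the free monoid under concatenation.  It is written additively because the
  product of \<^theory>\<open>HOL-Library.Poly_Mapping\<close> is convolution with respect to addition of
  exponents; this makes \<open>'g word \<Rightarrow>\<^sub>0 int\<close> the noncommutative polynomial ring over the integers
  with letters of type \<open>'g\<close>.
\<close>

datatype 'g word = Word (letters: "'g list")

instantiation word :: (type) monoid_add
begin

definition zero_word :: "'g word" where
  "zero_word = Word []"

definition plus_word :: "'g word \<Rightarrow> 'g word \<Rightarrow> 'g word" where
  "plus_word u v = Word (letters u @ letters v)"

instance
  by standard (simp_all add: zero_word_def plus_word_def)

end

type_synonym 'g ncpoly = "'g word \<Rightarrow>\<^sub>0 int"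

definition gen :: "'g \<Rightarrow> 'g ncpoly" where
  "gen g = Poly_Mapping.single (Word [g]) 1"

definition free_algebra :: "'g set \<Rightarrow> 'g ncpoly ring" where
  "free_algebra G =
    \<lparr>carrier = {p. \<forall>w \<in> Poly_Mapping.keys p. set (letters w) \<subseteq> G},
     monoid.mult = (*), one = 1, zero = 0, add = (+)\<rparr>"

lemma carrier_free_algebra:
  "p \<in> carrier (free_algebra G) \<longleftrightarrow> (\<forall>w \<in> Poly_Mapping.keys p. set (letters w) \<subseteq> G)"
  by (simp add: free_algebra_def)

lemma free_algebra_one: "1 \<in> carrier (free_algebra G)"
  by (simp add: carrier_free_algebra zero_word_def)

lemma free_algebra_gen: "g \<in> G \<Longrightarrow> gen g \<in> carrier (free_algebra G)"
  by (simp add: carrier_free_algebra gen_def)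

lemma free_algebra_add:
  "p \<in> carrier (free_algebra G) \<Longrightarrow> q \<in> carrier (free_algebra G) \<Longrightarrow>
   p + q \<in> carrier (free_algebra G)"
  using Poly_Mapping.keys_add[of p q] unfolding carrier_free_algebra by blast

lemma free_algebra_uminus:
  "p \<in> carrier (free_algebra G) \<Longrightarrow> - p \<in> carrier (free_algebra G)"
  by (simp add: carrier_free_algebra)

lemma free_algebra_diff:
  "p \<in> carrier (free_algebra G) \<Longrightarrow> q \<in> carrier (free_algebra G) \<Longrightarrow>
   p - q \<in> carrier (free_algebra G)"
  using free_algebra_add[OF _ free_algebra_uminus, of p G q] by simp

lemma free_algebra_mult:
  assumes "p \<in> carrier (free_algebra G)" and "q \<in> carrier (free_algebra G)"
  shows "p * q \<in> carrier (free_algebra G)"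
  unfolding carrier_free_algebra
proof
  fix w assume "w \<in> Poly_Mapping.keys (p * q)"
  then obtain u v where "u \<in> Poly_Mapping.keys p" "v \<in> Poly_Mapping.keys q" "w = u + v"
    using Poly_Mapping.keys_mult[of p q] by blast
  then show "set (letters w) \<subseteq> G"
    using assms by (auto simp: carrier_free_algebra plus_word_def)
qed

lemmas free_algebra_closed =
  free_algebra_one free_algebra_gen free_algebra_add free_algebra_diff free_algebra_mult

lemma ring_free_algebra:
  fixes G :: "'g set"
  shows "ring (free_algebra G)"
proof -
  have ops: "x \<oplus>\<^bsub>free_algebra G\<^esub> y = x + y" "x \<otimes>\<^bsub>free_algebra G\<^esub> y = x * y"
    "\<zero>\<^bsub>free_algebra G\<^esub> = 0" "\<one>\<^bsub>free_algebra G\<^esub> = 1" for x y :: "'g ncpoly"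
    by (simp_all add: free_algebra_def)
  have zero: "(0 :: 'g ncpoly) \<in> carrier (free_algebra G)"
    by (simp add: carrier_free_algebra)
  have inverse: "\<exists>q \<in> carrier (free_algebra G). q + p = 0"
    if "p \<in> carrier (free_algebra G)" for p :: "'g ncpoly"
    by (rule bexI[OF _ free_algebra_uminus[OF that]]) (rule left_minus)
  show ?thesis
    by (intro ringI abelian_groupI Group.monoidI; unfold ops)
      (rule free_algebra_add free_algebra_mult free_algebra_one zero inverse
        add.assoc add.commute mult.assoc add_0_left mult_1_left mult_1_right
        distrib_right distrib_left; assumption)+
qed

text \<open>
  The relations are given as a set of elements that become zero.  Both arguments must match:
  \<^const>\<open>genideal\<close> is only meaningful when \<open>R \<subseteq> carrier (free_algebra G)\<close>.
\<close>

definition presented_algebra :: "'g set \<Rightarrow> 'g ncpoly set \<Rightarrow> 'g ncpoly set ring" where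
  "presented_algebra G R = free_algebra G Quot genideal (free_algebra G) R"

definition presented_gen :: "'g set \<Rightarrow> 'g ncpoly set \<Rightarrow> 'g \<Rightarrow> 'g ncpoly set" where
  "presented_gen G R g = genideal (free_algebra G) R +>\<^bsub>free_algebra G\<^esub> gen g"

lemma ring_presented_algebra:
  assumes "R \<subseteq> carrier (free_algebra G)"
  shows "ring (presented_algebra G R)"
proof -
  interpret ring "free_algebra G" by (rule ring_free_algebra)
  show ?thesis
    unfolding presented_algebra_def
    by (rule ideal.quotient_is_ring[OF genideal_ideal[OF assms]])
qed


section \<open>Skew polynomials\<close>

definition Pol_rels :: "nat \<Rightarrow> nat ncpoly set" where
  "Pol_rels n = {gen i * gen j + gen j * gen i | i j. i \<in> {1..n} \<and> j \<in> {1..n} \<and> i \<noteq> j}"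

definition Pol :: "nat \<Rightarrow> nat ncpoly set ring" where
  "Pol n = presented_algebra {1..n} (Pol_rels n)"

definition pol_x :: "nat \<Rightarrow> nat \<Rightarrow> nat ncpoly set" where
  "pol_x n i = presented_gen {1..n} (Pol_rels n) i"

lemma ring_Pol: "ring (Pol n)"
  unfolding Pol_def
  by (rule ring_presented_algebra) (auto simp: Pol_rels_def intro!: free_algebra_closed)


section \<open>The spin type D nilHecke algebra\<close>

text \<open>\<open>Del i\<close> stands for $\partial_i^-$ and \<open>DelD\<close> for $\partial_n^D$.\<close>

datatype nh_gen = X nat | Del nat | DelD

definition NHD_gens :: "nat \<Rightarrow> nh_gen set" where
  "NHD_gens n = X ` {1..n} \<union> Del ` {1..n-1} \<union> {DelD}"

abbreviation (input) fx :: "nat \<Rightarrow> nh_gen ncpoly" where "fx i \<equiv> gen (X i)"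
abbreviation (input) fd :: "nat \<Rightarrow> nh_gen ncpoly" where "fd i \<equiv> gen (Del i)"
abbreviation (input) fD :: "nh_gen ncpoly" where "fD \<equiv> gen DelD"

inductive_set NHD_rels :: "nat \<Rightarrow> nh_gen ncpoly set" for n :: nat where
  x_x: "\<lbrakk>i \<in> {1..n}; j \<in> {1..n}; i \<noteq> j\<rbrakk> \<Longrightarrow> fx i * fx j + fx j * fx i \<in> NHD_rels n"
| d_sq: "i \<in> {1..n-1} \<Longrightarrow> fd i * fd i \<in> NHD_rels n"
| d_braid: "\<lbrakk>i \<in> {1..n-1}; i + 1 \<in> {1..n-1}\<rbrakk> \<Longrightarrow>
    fd i * fd (i+1) * fd i - fd (i+1) * fd i * fd (i+1) \<in> NHD_rels n"
| d_d: "\<lbrakk>i \<in> {1..n-1}; j \<in> {1..n-1}; \<bar>int i - int j\<bar> > 1\<rbrakk> \<Longrightarrow>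
    fd i * fd j + fd j * fd i \<in> NHD_rels n"
| x_d: "i \<in> {1..n-1} \<Longrightarrow> fx i * fd i + fd i * fx (i+1) - 1 \<in> NHD_rels n"
| d_x: "i \<in> {1..n-1} \<Longrightarrow> fd i * fx i + fx (i+1) * fd i - 1 \<in> NHD_rels n"
| d_x_far: "\<lbrakk>i \<in> {1..n-1}; j \<in> {1..n}; j \<noteq> i; j \<noteq> i + 1\<rbrakk> \<Longrightarrow>
    fd i * fx j + fx j * fd i \<in> NHD_rels n"
| D_sq: "fD * fD \<in> NHD_rels n"
| D_braid: "n \<ge> 3 \<Longrightarrow> fD * fd (n-2) * fD - fd (n-2) * fD * fd (n-2) \<in> NHD_rels n"
| D_d: "\<lbrakk>1 \<le> i; i + 3 \<le> n\<rbrakk> \<Longrightarrow> fD * fd i + fd i * fD \<in> NHD_rels n"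
| D_d_last: "fD * fd (n-1) - fd (n-1) * fD \<in> NHD_rels n"
| x_D: "fx (n-1) * fD - fD * fx n - 1 \<in> NHD_rels n"
| D_x: "fD * fx (n-1) - fx n * fD - 1 \<in> NHD_rels n"
| D_x_far: "\<lbrakk>1 \<le> i; i + 2 \<le> n\<rbrakk> \<Longrightarrow> fD * fx i + fx i * fD \<in> NHD_rels n"

definition NHD :: "nat \<Rightarrow> nh_gen ncpoly set ring" where
  "NHD n = presented_algebra (NHD_gens n) (NHD_rels n)"

definition nhd_x :: "nat \<Rightarrow> nat \<Rightarrow> nh_gen ncpoly set" where
  "nhd_x n i = presented_gen (NHD_gens n) (NHD_rels n) (X i)"

definition nhd_d :: "nat \<Rightarrow> nat \<Rightarrow> nh_gen ncpoly set" where
  "nhd_d n i = presented_gen (NHD_gens n) (NHD_rels n) (Del i)"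

definition nhd_D :: "nat \<Rightarrow> nh_gen ncpoly set" where
  "nhd_D n = presented_gen (NHD_gens n) (NHD_rels n) DelD"

lemma NHD_rels_closed:
  assumes "2 \<le> n"
  shows "NHD_rels n \<subseteq> carrier (free_algebra (NHD_gens n))"
proof
  fix p assume "p \<in> NHD_rels n"
  moreover have "X i \<in> NHD_gens n" if "1 \<le> i" "i \<le> n" for i
    using that by (simp add: NHD_gens_def)
  moreover have "Del i \<in> NHD_gens n" if "1 \<le> i" "i \<le> n - 1" for i
    using that by (simp add: NHD_gens_def)
  moreover have "DelD \<in> NHD_gens n"
    by (simp add: NHD_gens_def)
  ultimately show "p \<in> carrier (free_algebra (NHD_gens n))"
    using assms
    by cases (auto intro!: free_algebra_closed)
qed

lemma ring_NHD: "2 \<le> n \<Longrightarrow> ring (NHD n)"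
  unfolding NHD_def by (intro ring_presented_algebra NHD_rels_closed)


section \<open>Additive endomorphisms\<close>

text \<open>
  The ring of $\mathbb{Z}$-linear operators on a ring.  Operators are extensional, i.e. equal to
  \<^const>\<open>undefined\<close> outside the carrier, so that equality of operators is equality on the carrier.
\<close>

definition End :: "('a, 'b) ring_scheme \<Rightarrow> ('a \<Rightarrow> 'a) ring" where
  "End R =
    \<lparr>carrier = hom (add_monoid R) (add_monoid R) \<inter> extensional (carrier R),
     monoid.mult = compose (carrier R),
     one = (\<lambda>f \<in> carrier R. f),
     zero = (\<lambda>f \<in> carrier R. \<zero>\<^bsub>R\<^esub>),
     add = (\<lambda>S T. \<lambda>f \<in> carrier R. S f \<oplus>\<^bsub>R\<^esub> T f)\<rparr>"

definition left_mult :: "('a, 'b) ring_scheme \<Rightarrow> 'a \<Rightarrow> 'a \<Rightarrow> 'a" where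
  "left_mult R a = (\<lambda>f \<in> carrier R. a \<otimes>\<^bsub>R\<^esub> f)"


section \<open>Odd Demazure operators of type D\<close>

text \<open>
  The twisting endomorphisms and the Demazure operators are specified by their values on the
  generators together with multiplicativity and the twisted Leibniz rule, respectively.  They are
  selected by definite description, so nothing can be derived about them before the existence
  and uniqueness of the specified map has been proved.
\<close>

definition is_pol_endo :: "nat \<Rightarrow> (nat \<Rightarrow> nat ncpoly set) \<Rightarrow> (nat ncpoly set \<Rightarrow> nat ncpoly set) \<Rightarrow> bool"
  where "is_pol_endo n v s \<longleftrightarrow>
    s \<in> ring_hom (Pol n) (Pol n) \<and> s \<in> extensional (carrier (Pol n)) \<and>
    (\<forall>j \<in> {1..n}. s (pol_x n j) = v j)"

definition s_odd :: "nat \<Rightarrow> nat \<Rightarrow> nat ncpoly set \<Rightarrow> nat ncpoly set" where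
  "s_odd n i = (THE s. is_pol_endo n
    (\<lambda>j. \<ominus>\<^bsub>Pol n\<^esub> pol_x n (if j = i then i + 1 else if j = i + 1 then i else j)) s)"

definition s_D :: "nat \<Rightarrow> nat ncpoly set \<Rightarrow> nat ncpoly set" where
  "s_D n = (THE s. is_pol_endo n
    (\<lambda>j. if j = n then pol_x n (n - 1) else if j = n - 1 then pol_x n n
         else \<ominus>\<^bsub>Pol n\<^esub> pol_x n j) s)"

definition is_twisted_derivation ::
  "nat \<Rightarrow> (nat ncpoly set \<Rightarrow> nat ncpoly set) \<Rightarrow> (nat \<Rightarrow> nat ncpoly set) \<Rightarrow>
   (nat ncpoly set \<Rightarrow> nat ncpoly set) \<Rightarrow> bool"
  where "is_twisted_derivation n s c d \<longleftrightarrow>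
    d \<in> carrier (End (Pol n)) \<and>
    d \<one>\<^bsub>Pol n\<^esub> = \<zero>\<^bsub>Pol n\<^esub> \<and>
    (\<forall>j \<in> {1..n}. d (pol_x n j) = c j) \<and>
    (\<forall>f \<in> carrier (Pol n). \<forall>g \<in> carrier (Pol n).
      d (f \<otimes>\<^bsub>Pol n\<^esub> g) = (d f \<otimes>\<^bsub>Pol n\<^esub> g) \<oplus>\<^bsub>Pol n\<^esub> (s f \<otimes>\<^bsub>Pol n\<^esub> d g))"

definition demazure :: "nat \<Rightarrow> nat \<Rightarrow> nat ncpoly set \<Rightarrow> nat ncpoly set" where
  "demazure n i = (THE d. is_twisted_derivation n (s_odd n i)
    (\<lambda>j. if j = i \<or> j = i + 1 then \<one>\<^bsub>Pol n\<^esub> else \<zero>\<^bsub>Pol n\<^esub>) d)"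

definition demazure_D :: "nat \<Rightarrow> nat ncpoly set \<Rightarrow> nat ncpoly set" where
  "demazure_D n = (THE d. is_twisted_derivation n (s_D n)
    (\<lambda>j. if j = n then \<ominus>\<^bsub>Pol n\<^esub> \<one>\<^bsub>Pol n\<^esub> else if j = n - 1 then \<one>\<^bsub>Pol n\<^esub> else \<zero>\<^bsub>Pol n\<^esub>) d)"

end

theory Submission
  imports Defs
begin

text \<open>
  By the universal property of rings presented by generators and relations, a representation is
  the same as a choice of operators for the generators that satisfies the defining relations. So the
  matter is to know the operators well enough to check the relations.

  \<^bold>\<open>Existence of the operators.\<close> A twisted derivation with twist \<open>s\<close> is the corner of a ring
  homomorphism to upper triangular matrices, with \<open>s f\<close> and \<open>f\<close> on the diagonal. The universal
  property of the skew polynomial ring produces this homomorphism from its values on the variables,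
  as soon as the images of the variables anticommute (\<open>pol_endo_ex1\<close>, \<open>twisted_derivation_ex1\<close>).

  \<^bold>\<open>Type A relations.\<close> With a variable as first factor the Leibniz rule reads
  \<open>d y\<^sub>p = 1 - y\<^sub>q d\<close>, \<open>d y\<^sub>q = 1 - y\<^sub>p d\<close> and \<open>d y\<^sub>j = - y\<^sub>j d\<close> otherwise. This already contains the mixed
  relations. In a relation between products of such operators both sides agree at \<open>1\<close>, and moving a
  variable through both sides gives the same recursion. Since skew polynomials are built from \<open>1\<close> by
  subtraction and left multiplication by variables, the two sides agree everywhere
  (\<open>operators_eqI\<close> and the lemmas after it).

  \<^bold>\<open>Type D relations.\<close> In the variables \<open>x\<^sub>1, \<dots>, x\<^sub>n\<^sub>-\<^sub>1, - x\<^sub>n\<close> the operator $\partial_n^D$ obeys the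
  type A rules for the last pair (\<open>demazure_D_odd_divided_difference\<close>), while $\partial_i^-$ with
  \<open>i \<le> n - 2\<close> obeys the same rules as before. Hence the square of $\partial_n^D$ and its relations with
  these $\partial_i^-$ are type A relations in the new variables. Only the relation between $\partial_n^D$ and
  $\partial_{n-1}^-$ mixes both families of variables; it is \<open>odd_dd_commute_opposite\<close>.
\<close>

section \<open>The universal property of a presented ring\<close>

text \<open>
  Elements of a ring \<open>S\<close> assigned to the letters extend to all noncommutative polynomials by
  sending a word to the product of its letters and extending additively; since this map is
  multiplicative, it is a ring homomorphism.
\<close>

definition word_value :: "('a, 'b) ring_scheme \<Rightarrow> ('g \<Rightarrow> 'a) \<Rightarrow> 'g word \<Rightarrow> 'a" where
  "word_value S v w = foldr (\<lambda>g a. v g \<otimes>\<^bsub>S\<^esub> a) (letters w) \<one>\<^bsub>S\<^esub>"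

definition nc_eval :: "('a, 'b) ring_scheme \<Rightarrow> ('g \<Rightarrow> 'a) \<Rightarrow> 'g ncpoly \<Rightarrow> 'a" where
  "nc_eval S v p =
    (\<Oplus>\<^bsub>S\<^esub>w\<in>Poly_Mapping.keys p. [Poly_Mapping.lookup p w] \<cdot>\<^bsub>S\<^esub> word_value S v w)"

lemma free_algebra_sel [simp]:
  "monoid.mult (free_algebra G) = (*)" "monoid.one (free_algebra G) = 1"
  "ring.zero (free_algebra G) = 0" "ring.add (free_algebra G) = (+)"
  by (simp_all add: free_algebra_def)

context ring
begin

lemma int_multiple_zero: "[(0 :: int)] \<cdot> a = \<zero>"
  by (simp add: add_pow_def)

text \<open>
  Letters are given values everywhere, not only on a generating set: then the evaluation is additive
  and multiplicative on all polynomials, without side conditions on their support.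
\<close>

context
  fixes v :: "'g \<Rightarrow> 'a"
  assumes v: "\<And>g. v g \<in> carrier R"
begin

lemma word_value_zero: "word_value R v 0 = \<one>"
  by (simp add: word_value_def zero_word_def)

lemma word_value_closed:
  "word_value R v w \<in> carrier R"
proof -
  have "foldr (\<lambda>g a. v g \<otimes> a) gs \<one> \<in> carrier R" for gs
    using v by (induction gs) auto
  then show ?thesis by (simp add: word_value_def)
qed

lemma word_value_plus:
  "word_value R v (u + w) = word_value R v u \<otimes> word_value R v w"
proof -
  have cl: "foldr (\<lambda>g a. v g \<otimes> a) gs \<one> \<in> carrier R" for gs
    using word_value_closed[of "Word gs"] by (simp add: word_value_def)
  have "foldr (\<lambda>g a. v g \<otimes> a) (gs @ hs) \<one> =
    foldr (\<lambda>g a. v g \<otimes> a) gs \<one> \<otimes> foldr (\<lambda>g a. v g \<otimes> a) hs \<one>" for gs hs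
  proof (induction gs)
    case Nil
    then show ?case using cl by simp
  next
    case (Cons g gs)
    then show ?case using v cl by (simp add: m_assoc del: foldr_append)
  qed
  then show ?thesis by (simp add: word_value_def plus_word_def)
qed

text \<open>A common finite index set makes two evaluations comparable summand by summand.\<close>

lemma nc_eval_superset:
  assumes K: "finite K" "Poly_Mapping.keys p \<subseteq> K"
  shows "nc_eval R v p = (\<Oplus>w\<in>K. [Poly_Mapping.lookup p w] \<cdot> word_value R v w)"
  unfolding nc_eval_def
  using K word_value_closed
  by (intro add.finprod_mono_neutral_cong_left) (auto simp: in_keys_iff int_multiple_zero)

lemma nc_eval_closed:
  "nc_eval R v p \<in> carrier R"
  unfolding nc_eval_def using word_value_closed by auto

lemma nc_eval_add:
  "nc_eval R v (p + q) = nc_eval R v p \<oplus> nc_eval R v q"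
proof -
  let ?K = "Poly_Mapping.keys p \<union> Poly_Mapping.keys q"
  have "nc_eval R v (p + q) = (\<Oplus>w\<in>?K. [Poly_Mapping.lookup (p + q) w] \<cdot> word_value R v w)"
    using Poly_Mapping.keys_add[of p q] by (intro nc_eval_superset) auto
  also have "\<dots> = (\<Oplus>w\<in>?K. [Poly_Mapping.lookup p w] \<cdot> word_value R v w \<oplus>
      [Poly_Mapping.lookup q w] \<cdot> word_value R v w)"
    using word_value_closed by (simp add: lookup_add add.int_pow_mult)
  also have "\<dots> = (\<Oplus>w\<in>?K. [Poly_Mapping.lookup p w] \<cdot> word_value R v w) \<oplus>
      (\<Oplus>w\<in>?K. [Poly_Mapping.lookup q w] \<cdot> word_value R v w)"
    using word_value_closed by (intro add.finprod_multf) auto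
  also have "\<dots> = nc_eval R v p \<oplus> nc_eval R v q"
    using nc_eval_superset[of ?K p] nc_eval_superset[of ?K q] by simp
  finally show ?thesis .
qed

lemma nc_eval_zero: "nc_eval R v 0 = \<zero>"
  by (simp add: nc_eval_def)

lemma nc_eval_diff:
  "nc_eval R v (p - q) = nc_eval R v p \<ominus> nc_eval R v q"
proof -
  have "nc_eval R v p = nc_eval R v (p - q) \<oplus> nc_eval R v q"
    using nc_eval_add[of "p - q" q] by simp
  then show ?thesis
    using nc_eval_closed by (simp add: minus_eq a_assoc r_neg)
qed

lemma nc_eval_monomial:
  "nc_eval R v (frag_of w) = word_value R v w"
  using word_value_closed by (simp add: nc_eval_def)

text \<open>
  Both sides are biadditive, so it suffices to compare them on words, where multiplication is
  concatenation.
\<close>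

lemma nc_eval_mult:
  "nc_eval R v (p * q) = nc_eval R v p \<otimes> nc_eval R v q"
proof -
  note cl = nc_eval_closed
  have dr: "a \<otimes> (b \<ominus> c) = a \<otimes> b \<ominus> a \<otimes> c" "(b \<ominus> c) \<otimes> a = b \<otimes> a \<ominus> c \<otimes> a"
    if "a \<in> carrier R" "b \<in> carrier R" "c \<in> carrier R" for a b c
    using that by (simp_all add: minus_eq l_distr r_distr l_minus r_minus)
  have monomial: "nc_eval R v (frag_of u * q) = nc_eval R v (frag_of u) \<otimes> nc_eval R v q" for u
    using subset_UNIV[of "Poly_Mapping.keys q"]
  proof (induction q rule: frag_induction)
    case zero
    then show ?case using cl by (simp add: nc_eval_zero)
  next
    case (one w)
    then show ?case by (simp add: mult_single nc_eval_monomial word_value_plus)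
  next
    case (diff a b)
    then show ?case by (simp add: right_diff_distrib nc_eval_diff dr cl)
  qed
  show ?thesis
    using subset_UNIV[of "Poly_Mapping.keys p"]
  proof (induction p rule: frag_induction)
    case zero
    then show ?case using cl by (simp add: nc_eval_zero)
  next
    case (one w)
    show ?case by (rule monomial)
  next
    case (diff a b)
    then show ?case by (simp add: left_diff_distrib nc_eval_diff dr cl)
  qed
qed

end

lemma free_algebra_universal:
  assumes v: "\<And>g. g \<in> G \<Longrightarrow> v g \<in> carrier R"
  shows "\<exists>h \<in> ring_hom (free_algebra G) R. \<forall>g\<in>G. h (gen g) = v g"
proof
  \<comment> \<open>Letters outside \<open>G\<close> do not occur in the free algebra on \<open>G\<close>; zero is an arbitrary value.\<close>
  define v' where "v' g = (if g \<in> G then v g else \<zero>)" for g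
  have v': "v' g \<in> carrier R" for g using v by (simp add: v'_def)
  have one: "nc_eval R v' 1 = \<one>"
    using nc_eval_monomial[of v' 0, OF v'] word_value_zero[of v', OF v'] by simp
  show "nc_eval R v' \<in> ring_hom (free_algebra G) R"
    by (rule ring_hom_memI) (simp_all add: nc_eval_closed nc_eval_mult nc_eval_add v' one)
  show "\<forall>g\<in>G. nc_eval R v' (gen g) = v g"
    using v by (simp add: gen_def nc_eval_monomial v') (simp add: word_value_def v'_def)
qed

end

lemma ring_hom_free_algebra_diff:
  assumes h: "h \<in> ring_hom (free_algebra G) S" and S: "ring S"
    and p: "p \<in> carrier (free_algebra G)" and q: "q \<in> carrier (free_algebra G)"
  shows "h (p - q) = h p \<ominus>\<^bsub>S\<^esub> h q"
proof -
  interpret S: ring S by fact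
  have "h p = h (p - q) \<oplus>\<^bsub>S\<^esub> h q"
    using ring_hom_add[OF h free_algebra_diff[OF p q] q] by simp
  then show ?thesis
    using ring_hom_closed[OF h free_algebra_diff[OF p q]] ring_hom_closed[OF h q]
    by (simp add: S.minus_eq S.a_assoc S.r_neg)
qed

text \<open>
  Induction along left multiplication by generators is the form in which generation is used for
  operators: a word is built from the empty word by prefixing letters, and subtraction alone yields
  all integer combinations of words.
\<close>

lemma free_algebra_induct [consumes 1, case_names one diff gen]:
  assumes p: "p \<in> carrier (free_algebra G)"
    and one: "P 1"
    and diff: "\<And>p q. \<lbrakk>p \<in> carrier (free_algebra G); q \<in> carrier (free_algebra G); P p; P q\<rbrakk>
      \<Longrightarrow> P (p - q)"
    and gen: "\<And>g p. \<lbrakk>g \<in> G; p \<in> carrier (free_algebra G); P p\<rbrakk> \<Longrightarrow> P (gen g * p)"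
  shows "P p"
proof -
  let ?P = "\<lambda>p. p \<in> carrier (free_algebra G) \<and> P p"
  have "?P (frag_of (Word gs))" if "set gs \<subseteq> G" for gs
    using that
  proof (induction gs)
    case Nil
    have "frag_of (Word []) = (1 :: 'a ncpoly)"
      by (metis single_one zero_word_def)
    then show ?case using one by (simp add: free_algebra_one)
  next
    case (Cons g gs)
    have "frag_of (Word (g # gs)) = gen g * frag_of (Word gs)"
      by (simp add: gen_def mult_single plus_word_def)
    then show ?case using Cons gen by (auto intro: free_algebra_mult free_algebra_gen)
  qed
  then have word: "?P (frag_of w)" if "w \<in> {w. set (letters w) \<subseteq> G}" for w
    using that by (cases w) auto
  have "Poly_Mapping.keys p \<subseteq> {w. set (letters w) \<subseteq> G}"
    using p by (auto simp: carrier_free_algebra)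
  then have "?P p"
  proof (induction p rule: frag_induction)
    case zero
    then show ?case using diff[OF free_algebra_one free_algebra_one one one]
      by (simp add: carrier_free_algebra)
  next
    case (one w)
    then show ?case by (rule word)
  next
    case (diff p q)
    then show ?case using assms(3) free_algebra_diff by blast
  qed
  then show ?thesis ..
qed

abbreviation (input) presented_class :: "'g set \<Rightarrow> 'g ncpoly set \<Rightarrow> 'g ncpoly \<Rightarrow> 'g ncpoly set" where
  "presented_class G R p \<equiv> genideal (free_algebra G) R +>\<^bsub>free_algebra G\<^esub> p"

lemma presented_class_hom:
  assumes "R \<subseteq> carrier (free_algebra G)"
  shows "presented_class G R \<in> ring_hom (free_algebra G) (presented_algebra G R)"
  unfolding presented_algebra_def
  using ideal.rcos_ring_hom[OF ring.genideal_ideal[OF ring_free_algebra assms]] .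

lemma carrier_presented_algebra:
  "carrier (presented_algebra G R) = presented_class G R ` carrier (free_algebra G)"
  by (auto simp: presented_algebra_def FactRing_def A_RCOSETS_def RCOSETS_def a_r_coset_def)

lemma presented_class_eq_zero:
  assumes "R \<subseteq> carrier (free_algebra G)" "r \<in> R"
  shows "presented_class G R r = \<zero>\<^bsub>presented_algebra G R\<^esub>"
proof -
  interpret F: ring "free_algebra G" by (rule ring_free_algebra)
  interpret ideal "genideal (free_algebra G) R" "free_algebra G"
    by (rule F.genideal_ideal[OF assms(1)])
  show ?thesis
    using F.genideal_self[OF assms(1)] assms(2)
    by (simp add: presented_algebra_def FactRing_def a_rcos_const subset_iff)
qed

lemma presented_algebra_induct [consumes 2, case_names one diff gen]:
  assumes R: "R \<subseteq> carrier (free_algebra G)" and f: "f \<in> carrier (presented_algebra G R)"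
    and one: "P \<one>\<^bsub>presented_algebra G R\<^esub>"
    and diff: "\<And>f g. \<lbrakk>f \<in> carrier (presented_algebra G R); g \<in> carrier (presented_algebra G R);
      P f; P g\<rbrakk> \<Longrightarrow> P (f \<ominus>\<^bsub>presented_algebra G R\<^esub> g)"
    and gen: "\<And>a f. \<lbrakk>a \<in> G; f \<in> carrier (presented_algebra G R); P f\<rbrakk> \<Longrightarrow>
      P (presented_gen G R a \<otimes>\<^bsub>presented_algebra G R\<^esub> f)"
  shows "P f"
proof -
  note h = presented_class_hom[OF R]
  obtain p where p: "p \<in> carrier (free_algebra G)" and f_eq: "f = presented_class G R p"
    using f by (auto simp: carrier_presented_algebra)
  from p have "P (presented_class G R p)"
  proof (induction p rule: free_algebra_induct)
    case one
    then show ?case using ring_hom_one[OF h] assms(3) by simp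
  next
    case (diff p q)
    then show ?case
      using assms(4) ring_hom_free_algebra_diff[OF h ring_presented_algebra[OF R]]
        ring_hom_closed[OF h] by simp
  next
    case (gen g p)
    then show ?case
      using assms(5)[of g "presented_class G R p"]
        ring_hom_mult[OF h free_algebra_gen[of g G], of p] ring_hom_closed[OF h]
      by (simp add: presented_gen_def)
  qed
  then show ?thesis by (simp add: f_eq)
qed

text \<open>
  A homomorphism that kills the relations kills the ideal they generate, hence is constant on its
  cosets and descends to the quotient.
\<close>

lemma presented_algebra_universal:
  assumes S: "ring S" and h: "h \<in> ring_hom (free_algebra G) S"
    and R: "R \<subseteq> carrier (free_algebra G)" and kills: "\<And>r. r \<in> R \<Longrightarrow> h r = \<zero>\<^bsub>S\<^esub>"
  shows "\<exists>\<phi> \<in> ring_hom (presented_algebra G R) S.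
    \<forall>g \<in> G. \<phi> (presented_gen G R g) = h (gen g)"
proof
  interpret F: ring "free_algebra G" by (rule ring_free_algebra)
  interpret I: ideal "genideal (free_algebra G) R" "free_algebra G"
    by (rule F.genideal_ideal[OF R])
  note kernel_ideal = ring_hom_ring.kernel_is_ideal[OF ring_hom_ringI2[OF ring_free_algebra S h]]
  let ?\<phi> = "\<lambda>C. the_elem (h ` C)"
  have "R \<subseteq> a_kernel (free_algebra G) S h"
    unfolding a_kernel_def' using R kills by blast
  then have "genideal (free_algebra G) R \<subseteq> a_kernel (free_algebra G) S h"
    unfolding genideal_def by (intro Inter_lower CollectI conjI kernel_ideal)
  then have zero: "h i = \<zero>\<^bsub>S\<^esub>" if "i \<in> genideal (free_algebra G) R" for i
    using that unfolding a_kernel_def' by blast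
  have class_value: "?\<phi> (presented_class G R p) = h p" if p: "p \<in> carrier (free_algebra G)" for p
  proof -
    have "h q = h p" if q: "q \<in> presented_class G R p" for q
    proof -
      obtain i where i: "i \<in> genideal (free_algebra G) R" "q = i + p"
        using q by (auto simp: a_r_coset_def')
      then show ?thesis
        using ring_hom_add[OF h I.Icarr[OF i(1)] p] zero[OF i(1)] ring_hom_closed[OF h p]
          abelian_monoid.l_zero[OF abelian_group.axioms(1)[OF ring.is_abelian_group[OF S]]] by simp
    qed
    moreover have "p \<in> presented_class G R p" using p by (rule I.a_rcos_self)
    ultimately have "h ` presented_class G R p = {h p}" by blast
    then show ?thesis by simp
  qed
  note c = presented_class_hom[OF R]
  show "?\<phi> \<in> ring_hom (presented_algebra G R) S"
  proof (rule ring_hom_memI)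
    fix f assume "f \<in> carrier (presented_algebra G R)"
    then show "?\<phi> f \<in> carrier S"
      using class_value ring_hom_closed[OF h] by (auto simp: carrier_presented_algebra)
  next
    fix f g assume "f \<in> carrier (presented_algebra G R)" "g \<in> carrier (presented_algebra G R)"
    then obtain p q where pq: "p \<in> carrier (free_algebra G)" "q \<in> carrier (free_algebra G)"
      "f = presented_class G R p" "g = presented_class G R q"
      by (auto simp: carrier_presented_algebra)
    show "?\<phi> (f \<otimes>\<^bsub>presented_algebra G R\<^esub> g) = ?\<phi> f \<otimes>\<^bsub>S\<^esub> ?\<phi> g"
      using class_value[OF F.m_closed[OF pq(1,2)]] class_value pq
        ring_hom_mult[OF c pq(1,2)] ring_hom_mult[OF h pq(1,2)] by simp
    show "?\<phi> (f \<oplus>\<^bsub>presented_algebra G R\<^esub> g) = ?\<phi> f \<oplus>\<^bsub>S\<^esub> ?\<phi> g"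
      using class_value[OF F.a_closed[OF pq(1,2)]] class_value pq
        ring_hom_add[OF c pq(1,2)] ring_hom_add[OF h pq(1,2)] by simp
  next
    show "?\<phi> \<one>\<^bsub>presented_algebra G R\<^esub> = \<one>\<^bsub>S\<^esub>"
      using class_value[OF F.one_closed] ring_hom_one[OF c] ring_hom_one[OF h] by simp
  qed
  show "\<forall>g \<in> G. ?\<phi> (presented_gen G R g) = h (gen g)"
    using class_value by (simp add: presented_gen_def free_algebra_gen)
qed

section \<open>The ring of additive endomorphisms\<close>

lemma additive_diff:
  assumes "abelian_group R" "abelian_group S"
    and closed: "\<And>f. f \<in> carrier R \<Longrightarrow> T f \<in> carrier S"
    and add: "\<And>f g. \<lbrakk>f \<in> carrier R; g \<in> carrier R\<rbrakk> \<Longrightarrow> T (f \<oplus>\<^bsub>R\<^esub> g) = T f \<oplus>\<^bsub>S\<^esub> T g"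
    and f: "f \<in> carrier R" and g: "g \<in> carrier R"
  shows "T (f \<ominus>\<^bsub>R\<^esub> g) = T f \<ominus>\<^bsub>S\<^esub> T g"
proof -
  interpret R: abelian_group R by fact
  interpret S: abelian_group S by fact
  have "T f = T (f \<ominus>\<^bsub>R\<^esub> g) \<oplus>\<^bsub>S\<^esub> T g"
    using add[of "f \<ominus>\<^bsub>R\<^esub> g" g] f g by (simp add: R.minus_eq R.a_assoc R.l_neg)
  then show ?thesis
    using closed f g by (simp add: S.minus_eq S.a_assoc S.r_neg)
qed

lemma ring_hom_diff:
  assumes "h \<in> ring_hom R S" "ring R" "ring S" "f \<in> carrier R" "g \<in> carrier R"
  shows "h (f \<ominus>\<^bsub>R\<^esub> g) = h f \<ominus>\<^bsub>S\<^esub> h g"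
  using assms
  by (intro additive_diff ring.is_abelian_group) (auto simp: ring_hom_closed ring_hom_add)

lemma End_iff:
  "T \<in> carrier (End R) \<longleftrightarrow> T \<in> carrier R \<rightarrow> carrier R \<and> T \<in> extensional (carrier R) \<and>
    (\<forall>f\<in>carrier R. \<forall>g\<in>carrier R. T (f \<oplus>\<^bsub>R\<^esub> g) = T f \<oplus>\<^bsub>R\<^esub> T g)"
  by (auto simp: End_def hom_def)

lemma End_apply:
  assumes "f \<in> carrier R"
  shows "(S \<otimes>\<^bsub>End R\<^esub> T) f = S (T f)" and "(S \<oplus>\<^bsub>End R\<^esub> T) f = S f \<oplus>\<^bsub>R\<^esub> T f"
    and "\<one>\<^bsub>End R\<^esub> f = f" and "\<zero>\<^bsub>End R\<^esub> f = \<zero>\<^bsub>R\<^esub>"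
  using assms by (simp_all add: End_def compose_eq)

lemma End_closed: "T \<in> carrier (End R) \<Longrightarrow> f \<in> carrier R \<Longrightarrow> T f \<in> carrier R"
  by (auto simp: End_iff)

lemma End_add:
  "\<lbrakk>T \<in> carrier (End R); f \<in> carrier R; g \<in> carrier R\<rbrakk> \<Longrightarrow> T (f \<oplus>\<^bsub>R\<^esub> g) = T f \<oplus>\<^bsub>R\<^esub> T g"
  by (simp add: End_iff)

lemma End_eqI:
  assumes "S \<in> carrier (End R)" "T \<in> carrier (End R)" "\<And>f. f \<in> carrier R \<Longrightarrow> S f = T f"
  shows "S = T"
  using assms by (intro extensionalityI[of _ "carrier R"]) (auto simp: End_iff)

context ring
begin

lemma End_diff:
  "\<lbrakk>T \<in> carrier (End R); f \<in> carrier R; g \<in> carrier R\<rbrakk> \<Longrightarrow> T (f \<ominus> g) = T f \<ominus> T g"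
  by (intro additive_diff is_abelian_group) (auto simp: End_closed End_add)

lemma End_zero: "T \<in> carrier (End R) \<Longrightarrow> T \<zero> = \<zero>"
  using End_diff[of T \<zero> \<zero>] by (simp add: minus_eq End_closed r_neg)

lemma End_uminus:
  "\<lbrakk>T \<in> carrier (End R); f \<in> carrier R\<rbrakk> \<Longrightarrow> T (\<ominus> f) = \<ominus> T f"
  using End_diff[of T \<zero> f] by (simp add: minus_eq End_closed End_zero)

lemma End_ops_closed:
  shows "\<lbrakk>S \<in> carrier (End R); T \<in> carrier (End R)\<rbrakk> \<Longrightarrow> S \<oplus>\<^bsub>End R\<^esub> T \<in> carrier (End R)"
    and "\<lbrakk>S \<in> carrier (End R); T \<in> carrier (End R)\<rbrakk> \<Longrightarrow> S \<otimes>\<^bsub>End R\<^esub> T \<in> carrier (End R)"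
    and "\<zero>\<^bsub>End R\<^esub> \<in> carrier (End R)" and "\<one>\<^bsub>End R\<^esub> \<in> carrier (End R)"
proof -
  show "S \<oplus>\<^bsub>End R\<^esub> T \<in> carrier (End R)" if "S \<in> carrier (End R)" "T \<in> carrier (End R)"
    unfolding End_iff using that
    by (auto simp: End_apply End_closed End_add a_ac) (simp add: End_def)
  show "S \<otimes>\<^bsub>End R\<^esub> T \<in> carrier (End R)" if "S \<in> carrier (End R)" "T \<in> carrier (End R)"
    unfolding End_iff using that
    by (auto simp: End_apply End_closed End_add) (simp add: End_def)
  show "\<zero>\<^bsub>End R\<^esub> \<in> carrier (End R)" "\<one>\<^bsub>End R\<^esub> \<in> carrier (End R)"
    by (auto simp: End_def hom_def)
qed

lemma ring_End: "ring (End R)"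
proof (rule ringI)
  show "abelian_group (End R)"
  proof (rule abelian_groupI)
    fix S assume S: "S \<in> carrier (End R)"
    let ?S' = "\<lambda>f \<in> carrier R. \<ominus> S f"
    have S': "?S' \<in> carrier (End R)"
      using S by (simp add: End_iff minus_add Pi_iff)
    have "?S' \<oplus>\<^bsub>End R\<^esub> S = \<zero>\<^bsub>End R\<^esub>"
      using S S' by (intro End_eqI[of _ R] End_ops_closed) (simp_all add: End_apply End_closed l_neg)
    with S' show "\<exists>T \<in> carrier (End R). T \<oplus>\<^bsub>End R\<^esub> S = \<zero>\<^bsub>End R\<^esub>" by blast
  next
    fix S T assume S: "S \<in> carrier (End R)" and T: "T \<in> carrier (End R)"
    then show "S \<oplus>\<^bsub>End R\<^esub> T = T \<oplus>\<^bsub>End R\<^esub> S"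
      by (intro End_eqI[of _ R] End_ops_closed) (simp_all add: End_apply End_closed a_comm)
    fix U assume U: "U \<in> carrier (End R)"
    with S T show "S \<oplus>\<^bsub>End R\<^esub> T \<oplus>\<^bsub>End R\<^esub> U = S \<oplus>\<^bsub>End R\<^esub> (T \<oplus>\<^bsub>End R\<^esub> U)"
      by (intro End_eqI[of _ R] End_ops_closed) (simp_all add: End_apply End_closed a_assoc)
  next
    fix S assume S: "S \<in> carrier (End R)"
    then show "\<zero>\<^bsub>End R\<^esub> \<oplus>\<^bsub>End R\<^esub> S = S"
      by (intro End_eqI[of _ R] End_ops_closed) (simp_all add: End_apply End_closed)
  qed (rule End_ops_closed; assumption)+
  show "Group.monoid (End R)"
  proof (rule monoidI)
    fix S T U assume "S \<in> carrier (End R)" "T \<in> carrier (End R)" "U \<in> carrier (End R)"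
    then show "S \<otimes>\<^bsub>End R\<^esub> T \<otimes>\<^bsub>End R\<^esub> U = S \<otimes>\<^bsub>End R\<^esub> (T \<otimes>\<^bsub>End R\<^esub> U)"
      by (intro End_eqI[of _ R] End_ops_closed) (simp_all add: End_apply End_closed)
  next
    fix S assume "S \<in> carrier (End R)"
    then show "\<one>\<^bsub>End R\<^esub> \<otimes>\<^bsub>End R\<^esub> S = S" "S \<otimes>\<^bsub>End R\<^esub> \<one>\<^bsub>End R\<^esub> = S"
      by (intro End_eqI[of _ R] End_ops_closed; simp add: End_apply End_closed)+
  qed (rule End_ops_closed; assumption)+
next
  fix S T U assume STU: "S \<in> carrier (End R)" "T \<in> carrier (End R)" "U \<in> carrier (End R)"
  then show "(S \<oplus>\<^bsub>End R\<^esub> T) \<otimes>\<^bsub>End R\<^esub> U = S \<otimes>\<^bsub>End R\<^esub> U \<oplus>\<^bsub>End R\<^esub> T \<otimes>\<^bsub>End R\<^esub> U"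
    by (intro End_eqI[of _ R] End_ops_closed) (simp_all add: End_apply End_closed)
  show "U \<otimes>\<^bsub>End R\<^esub> (S \<oplus>\<^bsub>End R\<^esub> T) = U \<otimes>\<^bsub>End R\<^esub> S \<oplus>\<^bsub>End R\<^esub> U \<otimes>\<^bsub>End R\<^esub> T"
    using STU by (intro End_eqI[of _ R] End_ops_closed) (simp_all add: End_apply End_closed End_add)
qed

lemma left_mult_End: "a \<in> carrier R \<Longrightarrow> left_mult R a \<in> carrier (End R)"
  by (simp add: End_iff left_mult_def r_distr)

end

section \<open>Twisted derivations of the skew polynomial ring\<close>

text \<open>
  A triple \<open>(a, b, c)\<close> stands for the upper triangular matrix with diagonal \<open>a\<close>, \<open>c\<close> and corner \<open>b\<close>.
  Multiplying such matrices reproduces the twisted Leibniz rule in the corner: \<open>d\<close> is additive and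
  satisfies \<open>d (f g) = d f g + s f d g\<close> and \<open>d 1 = 0\<close>, for a ring endomorphism \<open>s\<close>, exactly if
  \<open>f \<mapsto> (s f, d f, f)\<close> is a ring homomorphism.
\<close>

definition triangular_ring :: "('a, 'b) ring_scheme \<Rightarrow> ('a \<times> 'a \<times> 'a) ring" where
  "triangular_ring R =
    \<lparr>carrier = carrier R \<times> carrier R \<times> carrier R,
     monoid.mult = (\<lambda>(a, b, c) (a', b', c').
       (a \<otimes>\<^bsub>R\<^esub> a', (b \<otimes>\<^bsub>R\<^esub> c') \<oplus>\<^bsub>R\<^esub> (a \<otimes>\<^bsub>R\<^esub> b'), c \<otimes>\<^bsub>R\<^esub> c')),
     one = (\<one>\<^bsub>R\<^esub>, \<zero>\<^bsub>R\<^esub>, \<one>\<^bsub>R\<^esub>),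
     zero = (\<zero>\<^bsub>R\<^esub>, \<zero>\<^bsub>R\<^esub>, \<zero>\<^bsub>R\<^esub>),
     add = (\<lambda>(a, b, c) (a', b', c'). (a \<oplus>\<^bsub>R\<^esub> a', b \<oplus>\<^bsub>R\<^esub> b', c \<oplus>\<^bsub>R\<^esub> c'))\<rparr>"

lemma triangular_ring_sel:
  "carrier (triangular_ring R) = carrier R \<times> carrier R \<times> carrier R"
  "(a, b, c) \<otimes>\<^bsub>triangular_ring R\<^esub> (a', b', c') =
    (a \<otimes>\<^bsub>R\<^esub> a', (b \<otimes>\<^bsub>R\<^esub> c') \<oplus>\<^bsub>R\<^esub> (a \<otimes>\<^bsub>R\<^esub> b'), c \<otimes>\<^bsub>R\<^esub> c')"
  "\<one>\<^bsub>triangular_ring R\<^esub> = (\<one>\<^bsub>R\<^esub>, \<zero>\<^bsub>R\<^esub>, \<one>\<^bsub>R\<^esub>)"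
  "\<zero>\<^bsub>triangular_ring R\<^esub> = (\<zero>\<^bsub>R\<^esub>, \<zero>\<^bsub>R\<^esub>, \<zero>\<^bsub>R\<^esub>)"
  "(a, b, c) \<oplus>\<^bsub>triangular_ring R\<^esub> (a', b', c') = (a \<oplus>\<^bsub>R\<^esub> a', b \<oplus>\<^bsub>R\<^esub> b', c \<oplus>\<^bsub>R\<^esub> c')"
  by (simp_all add: triangular_ring_def)

lemma (in ring) ring_triangular_ring: "ring (triangular_ring R)"
proof -
  have inverse: "\<exists>u \<in> carrier (triangular_ring R). u \<oplus>\<^bsub>triangular_ring R\<^esub> t = \<zero>\<^bsub>triangular_ring R\<^esub>"
    if "t \<in> carrier (triangular_ring R)" for t
    using that
    by (cases t, intro bexI[of _ "(\<ominus> fst t, \<ominus> fst (snd t), \<ominus> snd (snd t))"])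
      (simp_all add: triangular_ring_sel l_neg)
  show ?thesis
    by (intro ringI abelian_groupI Group.monoidI;
        (rule inverse, assumption)?;
        (simp only: triangular_ring_sel split_paired_all mem_Times_iff fst_conv snd_conv)?;
        (simp add: triangular_ring_sel m_assoc l_distr r_distr a_ac))
qed

lemma Pol_rels_closed: "Pol_rels n \<subseteq> carrier (free_algebra {1..n})"
  by (auto simp: Pol_rels_def intro!: free_algebra_closed)

lemma pol_x_closed: "j \<in> {1..n} \<Longrightarrow> pol_x n j \<in> carrier (Pol n)"
  using ring_hom_closed[OF presented_class_hom[OF Pol_rels_closed] free_algebra_gen]
  by (simp add: pol_x_def Pol_def presented_gen_def)

lemmas Pol_induct [consumes 1, case_names one diff x] =
  presented_algebra_induct[OF Pol_rels_closed, folded Pol_def pol_x_def]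

lemma Pol_universal:
  assumes S: "ring S" and v: "\<And>j. j \<in> {1..n} \<Longrightarrow> v j \<in> carrier S"
    and anticommute: "\<And>i j. \<lbrakk>i \<in> {1..n}; j \<in> {1..n}; i \<noteq> j\<rbrakk> \<Longrightarrow>
      v i \<otimes>\<^bsub>S\<^esub> v j \<oplus>\<^bsub>S\<^esub> v j \<otimes>\<^bsub>S\<^esub> v i = \<zero>\<^bsub>S\<^esub>"
  shows "\<exists>\<phi> \<in> ring_hom (Pol n) S. \<forall>j \<in> {1..n}. \<phi> (pol_x n j) = v j"
proof -
  have "\<exists>h \<in> ring_hom (free_algebra {1..n}) S. \<forall>j \<in> {1..n}. h (gen j) = v j"
    by (rule ring.free_algebra_universal[OF S]) (rule v)
  then obtain h where h: "h \<in> ring_hom (free_algebra {1..n}) S"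
    and h_gen: "\<forall>j \<in> {1..n}. h (gen j) = v j"
    by blast
  have zero: "h r = \<zero>\<^bsub>S\<^esub>" if r_rel: "r \<in> Pol_rels n" for r
  proof -
    obtain i j where ij: "i \<in> {1..n}" "j \<in> {1..n}" "i \<noteq> j"
      and r: "r = gen i * gen j + gen j * gen i"
      using r_rel by (auto simp: Pol_rels_def)
    note gens = free_algebra_gen[OF ij(1)] free_algebra_gen[OF ij(2)]
    have "h r = h (gen i) \<otimes>\<^bsub>S\<^esub> h (gen j) \<oplus>\<^bsub>S\<^esub> h (gen j) \<otimes>\<^bsub>S\<^esub> h (gen i)"
      using ring_hom_add[OF h free_algebra_mult[OF gens] free_algebra_mult[OF gens(2,1)]]
      unfolding r free_algebra_sel
      by (simp only: ring_hom_mult[OF h gens, unfolded free_algebra_sel]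
          ring_hom_mult[OF h gens(2,1), unfolded free_algebra_sel])
    then show ?thesis
      by (simp only: bspec[OF h_gen ij(1)] bspec[OF h_gen ij(2)] anticommute[OF ij])
  qed
  have "\<exists>\<phi> \<in> ring_hom (Pol n) S. \<forall>j \<in> {1..n}. \<phi> (pol_x n j) = h (gen j)"
    unfolding Pol_def pol_x_def
    by (rule presented_algebra_universal[OF S h Pol_rels_closed]) (rule zero)
  then show ?thesis using h_gen by simp
qed

lemma pol_x_anticommute:
  assumes ij: "i \<in> {1..n}" "j \<in> {1..n}" "i \<noteq> j"
  shows "pol_x n i \<otimes>\<^bsub>Pol n\<^esub> pol_x n j \<oplus>\<^bsub>Pol n\<^esub> pol_x n j \<otimes>\<^bsub>Pol n\<^esub> pol_x n i = \<zero>\<^bsub>Pol n\<^esub>"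
proof -
  have "gen i * gen j + gen j * gen i \<in> Pol_rels n" using ij by (auto simp: Pol_rels_def)
  note zero = presented_class_eq_zero[OF Pol_rels_closed this, folded Pol_def]
  note h = presented_class_hom[OF Pol_rels_closed, folded Pol_def]
  note gens = free_algebra_gen[OF ij(1)] free_algebra_gen[OF ij(2)]
  show ?thesis
    using ring_hom_add[OF h free_algebra_mult[OF gens] free_algebra_mult[OF gens(2,1)]]
      ring_hom_mult[OF h gens] ring_hom_mult[OF h gens(2,1)] zero
    by (simp add: pol_x_def presented_gen_def)
qed

lemma Pol_hom_unique:
  assumes S: "ring S" and h: "h \<in> ring_hom (Pol n) S" and k: "k \<in> ring_hom (Pol n) S"
    and gens: "\<And>j. j \<in> {1..n} \<Longrightarrow> h (pol_x n j) = k (pol_x n j)"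
    and f: "f \<in> carrier (Pol n)"
  shows "h f = k f"
  using f
proof (induction f rule: Pol_induct)
  case one
  then show ?case using ring_hom_one[OF h] ring_hom_one[OF k] by simp
next
  case (diff f g)
  then show ?case using ring_hom_diff[OF h ring_Pol S] ring_hom_diff[OF k ring_Pol S] by simp
next
  case (x j f)
  then show ?case
    using ring_hom_mult[OF h pol_x_closed] ring_hom_mult[OF k pol_x_closed] gens by simp
qed

lemma restrict_ring_hom:
  assumes "ring R" "h \<in> ring_hom R S"
  shows "restrict h (carrier R) \<in> ring_hom R S"
proof -
  interpret ring R by fact
  show ?thesis using assms(2) by (auto simp: ring_hom_def)
qed

lemma pol_endo_ex1:
  assumes v: "\<And>j. j \<in> {1..n} \<Longrightarrow> v j \<in> carrier (Pol n)"
    and anticommute: "\<And>i j. \<lbrakk>i \<in> {1..n}; j \<in> {1..n}; i \<noteq> j\<rbrakk> \<Longrightarrow>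
      v i \<otimes>\<^bsub>Pol n\<^esub> v j \<oplus>\<^bsub>Pol n\<^esub> v j \<otimes>\<^bsub>Pol n\<^esub> v i = \<zero>\<^bsub>Pol n\<^esub>"
  shows "\<exists>!s. is_pol_endo n v s"
proof -
  have "\<exists>s \<in> ring_hom (Pol n) (Pol n). \<forall>j \<in> {1..n}. s (pol_x n j) = v j"
    by (rule Pol_universal[OF ring_Pol]) (rule v anticommute; assumption)+
  then obtain s where "s \<in> ring_hom (Pol n) (Pol n)" "\<forall>j \<in> {1..n}. s (pol_x n j) = v j"
    by blast
  then have "is_pol_endo n v (restrict s (carrier (Pol n)))"
    by (simp add: is_pol_endo_def restrict_ring_hom ring_Pol pol_x_closed)
  moreover have "s = s'" if "is_pol_endo n v s" "is_pol_endo n v s'" for s s'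
    using that Pol_hom_unique[OF ring_Pol, of s n n s']
    by (intro extensionalityI[of _ "carrier (Pol n)"]) (auto simp: is_pol_endo_def)
  ultimately show ?thesis by blast
qed

text \<open>
  The triples formed from the images under the twist, the prescribed values and the generators
  themselves anticommute pairwise: in the corner this is the last hypothesis, on the diagonal it
  holds because the twist is an endomorphism. The universal property then gives a homomorphism to
  triangular matrices whose corner is the derivation. Uniqueness is an induction along left
  multiplication by generators.
\<close>

lemma twisted_derivation_ex1:
  assumes s: "is_pol_endo n v s"
    and c: "\<And>j. j \<in> {1..n} \<Longrightarrow> c j \<in> carrier (Pol n)"
    and kills: "\<And>i j. \<lbrakk>i \<in> {1..n}; j \<in> {1..n}; i \<noteq> j\<rbrakk> \<Longrightarrow>
      (c i \<otimes>\<^bsub>Pol n\<^esub> pol_x n j \<oplus>\<^bsub>Pol n\<^esub> v i \<otimes>\<^bsub>Pol n\<^esub> c j) \<oplus>\<^bsub>Pol n\<^esub>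
      (c j \<otimes>\<^bsub>Pol n\<^esub> pol_x n i \<oplus>\<^bsub>Pol n\<^esub> v j \<otimes>\<^bsub>Pol n\<^esub> c i) = \<zero>\<^bsub>Pol n\<^esub>"
  shows "\<exists>!d. is_twisted_derivation n s c d"
proof -
  interpret P: ring "Pol n" by (rule ring_Pol)
  have s_hom: "s \<in> ring_hom (Pol n) (Pol n)" and s_x: "\<And>j. j \<in> {1..n} \<Longrightarrow> s (pol_x n j) = v j"
    using s by (auto simp: is_pol_endo_def)
  let ?T = "triangular_ring (Pol n)"
  have T: "ring ?T" by (rule P.ring_triangular_ring)
  let ?t = "\<lambda>j. (v j, c j, pol_x n j)"
  have v: "v j \<in> carrier (Pol n)" if "j \<in> {1..n}" for j
    using ring_hom_closed[OF s_hom pol_x_closed] s_x that by fastforce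
  have v_anticommute: "v i \<otimes>\<^bsub>Pol n\<^esub> v j \<oplus>\<^bsub>Pol n\<^esub> v j \<otimes>\<^bsub>Pol n\<^esub> v i = \<zero>\<^bsub>Pol n\<^esub>"
    if ij: "i \<in> {1..n}" "j \<in> {1..n}" "i \<noteq> j" for i j
  proof -
    note x = pol_x_closed[OF ij(1)] pol_x_closed[OF ij(2)]
    show ?thesis
      using arg_cong[OF pol_x_anticommute[OF ij], of s]
      by (simp add: ring_hom_add[OF s_hom] ring_hom_mult[OF s_hom] x s_x[OF ij(1)] s_x[OF ij(2)]
          ring_hom_zero[OF s_hom ring_Pol ring_Pol])
  qed
  have t: "?t j \<in> carrier ?T" if "j \<in> {1..n}" for j
    unfolding triangular_ring_sel using v[OF that] c[OF that] pol_x_closed[OF that] by blast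
  have t_anticommute: "?t i \<otimes>\<^bsub>?T\<^esub> ?t j \<oplus>\<^bsub>?T\<^esub> ?t j \<otimes>\<^bsub>?T\<^esub> ?t i = \<zero>\<^bsub>?T\<^esub>"
    if "i \<in> {1..n}" "j \<in> {1..n}" "i \<noteq> j" for i j
    unfolding triangular_ring_sel
    using v_anticommute[OF that] kills[OF that] pol_x_anticommute[OF that] by blast
  have "\<exists>\<phi> \<in> ring_hom (Pol n) ?T. \<forall>j \<in> {1..n}. \<phi> (pol_x n j) = ?t j"
    by (rule Pol_universal[OF T]) (rule t t_anticommute; assumption)+
  then obtain \<phi> where \<phi>: "\<phi> \<in> ring_hom (Pol n) ?T"
    and \<phi>_x: "\<And>j. j \<in> {1..n} \<Longrightarrow> \<phi> (pol_x n j) = ?t j"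
    by blast
  note \<phi>_mem = ring_hom_closed[OF \<phi>]
  have fst_hom: "fst \<circ> \<phi> \<in> ring_hom (Pol n) (Pol n)"
    and snd_hom: "snd \<circ> snd \<circ> \<phi> \<in> ring_hom (Pol n) (Pol n)"
    using ring_hom_mult[OF \<phi>] ring_hom_add[OF \<phi>] ring_hom_one[OF \<phi>] \<phi>_mem
    by (auto intro!: ring_hom_memI simp: triangular_ring_def case_prod_unfold mem_Times_iff)
  have fst_\<phi>: "fst (\<phi> f) = s f" if "f \<in> carrier (Pol n)" for f
    using Pol_hom_unique[OF ring_Pol fst_hom s_hom _ that] \<phi>_x s_x by simp
  have snd_\<phi>: "snd (snd (\<phi> f)) = f" if "f \<in> carrier (Pol n)" for f
    using Pol_hom_unique[OF ring_Pol snd_hom, of id f] \<phi>_x that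
    by (simp add: ring_hom_def)
  define d where "d = (\<lambda>f \<in> carrier (Pol n). fst (snd (\<phi> f)))"
  have "is_twisted_derivation n s c d"
    unfolding is_twisted_derivation_def
  proof (intro conjI ballI)
    show "d \<in> carrier (End (Pol n))"
      using ring_hom_add[OF \<phi>] \<phi>_mem
      by (simp add: End_iff d_def triangular_ring_def case_prod_unfold mem_Times_iff)
    show "d \<one>\<^bsub>Pol n\<^esub> = \<zero>\<^bsub>Pol n\<^esub>"
      using ring_hom_one[OF \<phi>] by (simp add: d_def triangular_ring_sel)
    show "d (pol_x n j) = c j" if "j \<in> {1..n}" for j
      using that \<phi>_x pol_x_closed by (simp add: d_def)
    show "d (f \<otimes>\<^bsub>Pol n\<^esub> g) = d f \<otimes>\<^bsub>Pol n\<^esub> g \<oplus>\<^bsub>Pol n\<^esub> s f \<otimes>\<^bsub>Pol n\<^esub> d g"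
      if "f \<in> carrier (Pol n)" "g \<in> carrier (Pol n)" for f g
      using that ring_hom_mult[OF \<phi>, of f g] fst_\<phi>[of f] snd_\<phi>[of g]
      by (simp add: d_def triangular_ring_def case_prod_unfold)
  qed
  moreover have "d = d'"
    if d: "is_twisted_derivation n s c d" and d': "is_twisted_derivation n s c d'" for d d'
  proof (rule End_eqI)
    show mem: "d \<in> carrier (End (Pol n))" "d' \<in> carrier (End (Pol n))"
      using d d' by (simp_all add: is_twisted_derivation_def)
    fix f assume "f \<in> carrier (Pol n)"
    then show "d f = d' f"
    proof (induction f rule: Pol_induct)
      case one
      then show ?case using d d' by (simp add: is_twisted_derivation_def)
    next
      case (diff f g)
      then show ?case by (simp add: P.End_diff mem)
    next
      case (x j f)
      then show ?case using d d' pol_x_closed by (simp add: is_twisted_derivation_def)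
    qed
  qed
  ultimately show ?thesis by blast
qed

section \<open>Odd divided differences\<close>

text \<open>
  The Leibniz rule with a generator as first factor is all that the relations need. In this form the
  twist disappears, and the rule refers only to a family \<open>y\<close> of generators, which may be the
  variables or the variables up to sign. The operator is attached to the pair of generators with
  indices \<open>p\<close> and \<open>q\<close>; for \<open>p = i\<close>, \<open>q = i + 1\<close> and the variables themselves these are the rules
  for $\partial_i^-$.
\<close>

definition odd_divided_difference ::
  "('a, 'b) ring_scheme \<Rightarrow> nat set \<Rightarrow> (nat \<Rightarrow> 'a) \<Rightarrow> nat \<Rightarrow> nat \<Rightarrow> ('a \<Rightarrow> 'a) \<Rightarrow> bool"
  where "odd_divided_difference R I y p q d \<longleftrightarrow>
    d \<in> carrier (End R) \<and> d \<one>\<^bsub>R\<^esub> = \<zero>\<^bsub>R\<^esub> \<and>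
    (\<forall>f \<in> carrier R.
      d (y p \<otimes>\<^bsub>R\<^esub> f) = f \<ominus>\<^bsub>R\<^esub> y q \<otimes>\<^bsub>R\<^esub> d f \<and>
      d (y q \<otimes>\<^bsub>R\<^esub> f) = f \<ominus>\<^bsub>R\<^esub> y p \<otimes>\<^bsub>R\<^esub> d f \<and>
      (\<forall>j \<in> I - {p, q}. d (y j \<otimes>\<^bsub>R\<^esub> f) = \<ominus>\<^bsub>R\<^esub> (y j \<otimes>\<^bsub>R\<^esub> d f)))"

text \<open>
  The second assumption expresses, as an induction principle, that the products of members of the
  family \<open>y\<close> generate the ring additively.
\<close>

locale generated_ring = ring R for R (structure) +
  fixes I :: "nat set" and y :: "nat \<Rightarrow> 'a"
  assumes y_closed: "j \<in> I \<Longrightarrow> y j \<in> carrier R"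
    and generated: "\<lbrakk>f \<in> carrier R; P \<one>;
      \<And>f g. \<lbrakk>f \<in> carrier R; g \<in> carrier R; P f; P g\<rbrakk> \<Longrightarrow> P (f \<ominus> g);
      \<And>j f. \<lbrakk>j \<in> I; f \<in> carrier R; P f\<rbrakk> \<Longrightarrow> P (y j \<otimes> f)\<rbrakk> \<Longrightarrow> P f"
begin

abbreviation odd_dd :: "nat \<Rightarrow> nat \<Rightarrow> ('a \<Rightarrow> 'a) \<Rightarrow> bool" where
  "odd_dd \<equiv> odd_divided_difference R I y"

lemma odd_dd_rules:
  assumes "odd_dd p q d"
  shows "f \<in> carrier R \<Longrightarrow> d f \<in> carrier R" "d \<one> = \<zero>" "d \<zero> = \<zero>"
    "\<lbrakk>f \<in> carrier R; g \<in> carrier R\<rbrakk> \<Longrightarrow> d (f \<oplus> g) = d f \<oplus> d g"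
    "f \<in> carrier R \<Longrightarrow> d (\<ominus> f) = \<ominus> d f"
    "f \<in> carrier R \<Longrightarrow> d (y p \<otimes> f) = f \<ominus> y q \<otimes> d f"
    "f \<in> carrier R \<Longrightarrow> d (y q \<otimes> f) = f \<ominus> y p \<otimes> d f"
    "\<lbrakk>f \<in> carrier R; j \<in> I; j \<noteq> p; j \<noteq> q\<rbrakk> \<Longrightarrow> d (y j \<otimes> f) = \<ominus> (y j \<otimes> d f)"
  using assms
  by (simp_all add: odd_divided_difference_def End_closed End_add End_uminus End_zero)

text \<open>
  This is the common proof scheme of all relations among divided differences: if moving a
  generator through both sides produces the same recursion, equality at \<open>1\<close> propagates to the whole ring.
\<close>

lemma operators_eqI:
  assumes f: "f \<in> carrier R" and one: "S \<one> = T \<one>"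
    and S: "\<And>f g. \<lbrakk>f \<in> carrier R; g \<in> carrier R\<rbrakk> \<Longrightarrow> S (f \<ominus> g) = S f \<ominus> S g"
    and T: "\<And>f g. \<lbrakk>f \<in> carrier R; g \<in> carrier R\<rbrakk> \<Longrightarrow> T (f \<ominus> g) = T f \<ominus> T g"
    and step: "\<And>j f. \<lbrakk>j \<in> I; f \<in> carrier R; S f = T f\<rbrakk> \<Longrightarrow> S (y j \<otimes> f) = T (y j \<otimes> f)"
  shows "S f = T f"
  using f by (rule generated) (simp_all add: one S T step)

lemmas normal_form = minus_eq minus_add r_minus r_distr a_ac y_closed

text \<open>
  By the two rules \<open>d y\<^sub>p = 1 - y\<^sub>q d\<close> and \<open>d y\<^sub>q = 1 - y\<^sub>p d\<close>, moving \<open>y\<^sub>p\<close> through \<open>d d\<close> gives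
  \<open>d - (1 - y\<^sub>p d) d = y\<^sub>p d d\<close>. So \<open>d d\<close> commutes with \<open>y\<^sub>p\<close>, likewise with every other generator, and it
  kills \<open>1\<close>.
\<close>

lemma odd_dd_square:
  assumes d: "odd_dd p q d" and pq: "p \<in> I" "q \<in> I" and f: "f \<in> carrier R"
  shows "d (d f) = \<zero>"
proof -
  note d_rules = odd_dd_rules[OF d]
  show ?thesis
  proof (rule operators_eqI[OF f, where T = "\<lambda>_. \<zero>"])
    fix j f assume j: "j \<in> I" and f: "f \<in> carrier R" and IH: "d (d f) = \<zero>"
    consider "j = p" | "j = q" | "j \<noteq> p" "j \<noteq> q" by blast
    then show "d (d (y j \<otimes> f)) = \<zero>"
      using f IH j pq by cases (simp_all add: d_rules normal_form r_neg r_neg1 r_neg2)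
  qed (simp_all add: d_rules normal_form)
qed

text \<open>
  Operators attached to disjoint pairs: each passes the generators of the other with a sign, and
  with this sign the two inhomogeneous terms cancel in \<open>d e + e d\<close>.
\<close>

lemma odd_dd_far:
  assumes d: "odd_dd p q d" and e: "odd_dd r s e"
    and I: "p \<in> I" "q \<in> I" "r \<in> I" "s \<in> I"
    and far: "p \<noteq> r" "p \<noteq> s" "q \<noteq> r" "q \<noteq> s"
    and f: "f \<in> carrier R"
  shows "d (e f) = \<ominus> e (d f)"
proof -
  note rules = odd_dd_rules[OF d] odd_dd_rules[OF e]
  show ?thesis
  proof (rule operators_eqI[OF f, where T = "\<lambda>f. \<ominus> e (d f)"])
    fix j f assume j: "j \<in> I" and f: "f \<in> carrier R" and IH: "d (e f) = \<ominus> e (d f)"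
    consider "j = p" | "j = q" | "j = r" | "j = s" | "j \<noteq> p" "j \<noteq> q" "j \<noteq> r" "j \<noteq> s" by blast
    then show "d (e (y j \<otimes> f)) = \<ominus> e (d (y j \<otimes> f))"
      using f IH j I far far[symmetric] by cases (simp_all add: rules normal_form)
  qed (simp_all add: rules normal_form)
qed

text \<open>
  With \<open>d d = 0 = e e\<close>, moving a generator through either side yields the same inhomogeneous term:
  \<open>d e\<close> for \<open>y\<^sub>p\<close>, \<open>d e + e d\<close> for \<open>y\<^sub>q\<close> and \<open>e d\<close> for \<open>y\<^sub>r\<close>. The homogeneous terms are
  \<open>- y\<^sub>r\<close>, \<open>- y\<^sub>q\<close> and \<open>- y\<^sub>p\<close> times the side itself.
\<close>

lemma odd_dd_braid:
  assumes d: "odd_dd p q d" and e: "odd_dd q r e"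
    and I: "p \<in> I" "q \<in> I" "r \<in> I" and distinct: "p \<noteq> q" "q \<noteq> r" "p \<noteq> r"
    and f: "f \<in> carrier R"
  shows "d (e (d f)) = e (d (e f))"
proof -
  note rules = odd_dd_rules[OF d] odd_dd_rules[OF e]
    odd_dd_square[OF d I(1,2)] odd_dd_square[OF e I(2,3)]
  show ?thesis
  proof (rule operators_eqI[OF f, where T = "\<lambda>f. e (d (e f))"])
    fix j f assume j: "j \<in> I" and f: "f \<in> carrier R" and IH: "d (e (d f)) = e (d (e f))"
    consider "j = p" | "j = q" | "j = r" | "j \<noteq> p" "j \<noteq> q" "j \<noteq> r" by blast
    then show "d (e (d (y j \<otimes> f))) = e (d (e (y j \<otimes> f)))"
      using f IH j I distinct distinct[symmetric] by cases (simp_all add: rules normal_form)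
  qed (simp_all add: rules normal_form)
qed

text \<open>
  For the pairs \<open>(y\<^sub>p, y\<^sub>q)\<close> and \<open>(y\<^sub>p, - y\<^sub>q)\<close> the generators are shared and the inhomogeneous terms
  of \<open>e d\<close> and \<open>d e\<close> coincide: they are \<open>d + e\<close> for \<open>y\<^sub>p\<close> and \<open>e - d\<close> for \<open>y\<^sub>q\<close>. Hence the
  operators commute, in contrast to the disjoint case.
\<close>

lemma odd_dd_commute_opposite:
  assumes d: "odd_dd p q d" and e: "odd_divided_difference R I (y(q := \<ominus> y q)) p q e"
    and I: "p \<in> I" "q \<in> I" and pq: "p \<noteq> q" and f: "f \<in> carrier R"
  shows "e (d f) = d (e f)"
proof -
  note d_rules = odd_dd_rules[OF d]
  have e_End: "e \<in> carrier (End R)" and e_one: "e \<one> = \<zero>"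
    using e by (simp_all add: odd_divided_difference_def)
  note End_rules = End_closed[OF e_End] End_add[OF e_End] End_uminus[OF e_End] End_zero[OF e_End]
  have e_p: "e (y p \<otimes> f) = f \<oplus> y q \<otimes> e f" if "f \<in> carrier R" for f
    using e that I pq
    by (simp add: odd_divided_difference_def End_rules minus_eq l_minus y_closed)
  have e_q: "e (y q \<otimes> f) = \<ominus> f \<oplus> y p \<otimes> e f" if f: "f \<in> carrier R" for f
  proof -
    have "\<ominus> e (y q \<otimes> f) = f \<ominus> y p \<otimes> e f"
      using e f I pq
      by (simp add: odd_divided_difference_def End_rules l_minus y_closed flip: End_uminus[OF e_End])
    then have "\<ominus> (\<ominus> e (y q \<otimes> f)) = \<ominus> (f \<ominus> y p \<otimes> e f)" by simp
    then show ?thesis using f I by (simp add: End_rules normal_form)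
  qed
  have e_other: "e (y j \<otimes> f) = \<ominus> (y j \<otimes> e f)"
    if "f \<in> carrier R" "j \<in> I" "j \<noteq> p" "j \<noteq> q" for f j
    using e that by (simp add: odd_divided_difference_def)
  note rules = d_rules End_rules e_one e_p e_q e_other
  show ?thesis
  proof (rule operators_eqI[OF f, where S = "\<lambda>f. e (d f)"])
    fix j f assume j: "j \<in> I" and f: "f \<in> carrier R" and IH: "e (d f) = d (e f)"
    consider "j = p" | "j = q" | "j \<noteq> p" "j \<noteq> q" by blast
    then show "e (d (y j \<otimes> f)) = d (e (y j \<otimes> f))"
      using f IH j I pq pq[symmetric] by cases (simp_all add: rules normal_form)
  qed (simp_all add: rules normal_form)
qed

end

context generated_ring
begin

lemma generated_ring_negate:
  assumes q: "q \<in> I"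
  shows "generated_ring R I (y(q := \<ominus> y q))"
proof
  show "(y(q := \<ominus> y q)) j \<in> carrier R" if "j \<in> I" for j
    using that q by (simp add: y_closed)
  fix f P
  assume f: "f \<in> carrier R" and one: "P \<one>"
    and diff: "\<And>f g. \<lbrakk>f \<in> carrier R; g \<in> carrier R; P f; P g\<rbrakk> \<Longrightarrow> P (f \<ominus> g)"
    and step: "\<And>j f. \<lbrakk>j \<in> I; f \<in> carrier R; P f\<rbrakk> \<Longrightarrow> P ((y(q := \<ominus> y q)) j \<otimes> f)"
  have zero: "P \<zero>"
    using diff[of \<one> \<one>] one by (simp add: minus_eq r_neg)
  have neg: "P (\<ominus> f)" if "f \<in> carrier R" "P f" for f
    using diff[of \<zero> f] zero that by (simp add: minus_eq)
  show "P f"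
    using f
  proof (rule generated)
    show "P \<one>" by (rule one)
    show "P (f \<ominus> g)" if "f \<in> carrier R" "g \<in> carrier R" "P f" "P g" for f g
      using that by (rule diff)
    show "P (y j \<otimes> f)" if j: "j \<in> I" and f: "f \<in> carrier R" "P f" for j f
    proof (cases "j = q")
      case True
      then show ?thesis
        using neg[OF _ step[OF j f]] j f by (simp add: y_closed l_minus)
    next
      case False
      then show ?thesis using step[OF j f] by simp
    qed
  qed
qed

text \<open>
  Away from its own pair an operator is insensitive to the signs of the generators. This lets
  divided differences for the variables be compared with those for variables of changed sign.
\<close>

lemma odd_dd_negate:
  assumes d: "odd_dd p q d" and r: "r \<in> I" "r \<noteq> p" "r \<noteq> q"
  shows "odd_divided_difference R I (y(r := \<ominus> y r)) p q d"
  using d r End_uminus[of d]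
  by (simp add: odd_divided_difference_def End_closed y_closed l_minus)

end

section \<open>The Demazure operators\<close>

lemma generated_ring_Pol: "generated_ring (Pol n) {1..n} (pol_x n)"
proof -
  interpret ring "Pol n" by (rule ring_Pol)
  show ?thesis
    by unfold_locales (fact pol_x_closed, rule Pol_induct)
qed

text \<open>
  The definite descriptions become usable here: under the hypotheses, the described twist and the
  described derivation both exist and are unique, and what remains of them is the Leibniz rule
  for a generator as first factor.
\<close>

lemma The_twisted_derivation:
  fixes n v c
  defines "s \<equiv> (THE s. is_pol_endo n v s)"
  defines "d \<equiv> (THE d. is_twisted_derivation n s c d)"
  assumes v: "\<And>j. j \<in> {1..n} \<Longrightarrow> v j \<in> carrier (Pol n)"
    and anticommute: "\<And>i j. \<lbrakk>i \<in> {1..n}; j \<in> {1..n}; i \<noteq> j\<rbrakk> \<Longrightarrow>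
      v i \<otimes>\<^bsub>Pol n\<^esub> v j \<oplus>\<^bsub>Pol n\<^esub> v j \<otimes>\<^bsub>Pol n\<^esub> v i = \<zero>\<^bsub>Pol n\<^esub>"
    and c: "\<And>j. j \<in> {1..n} \<Longrightarrow> c j \<in> carrier (Pol n)"
    and kills: "\<And>i j. \<lbrakk>i \<in> {1..n}; j \<in> {1..n}; i \<noteq> j\<rbrakk> \<Longrightarrow>
      (c i \<otimes>\<^bsub>Pol n\<^esub> pol_x n j \<oplus>\<^bsub>Pol n\<^esub> v i \<otimes>\<^bsub>Pol n\<^esub> c j) \<oplus>\<^bsub>Pol n\<^esub>
      (c j \<otimes>\<^bsub>Pol n\<^esub> pol_x n i \<oplus>\<^bsub>Pol n\<^esub> v j \<otimes>\<^bsub>Pol n\<^esub> c i) = \<zero>\<^bsub>Pol n\<^esub>"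
  shows "d \<in> carrier (End (Pol n)) \<and> d \<one>\<^bsub>Pol n\<^esub> = \<zero>\<^bsub>Pol n\<^esub> \<and>
    (\<forall>j \<in> {1..n}. \<forall>f \<in> carrier (Pol n).
      d (pol_x n j \<otimes>\<^bsub>Pol n\<^esub> f) = c j \<otimes>\<^bsub>Pol n\<^esub> f \<oplus>\<^bsub>Pol n\<^esub> v j \<otimes>\<^bsub>Pol n\<^esub> d f)"
proof -
  have "\<exists>!s. is_pol_endo n v s"
    by (rule pol_endo_ex1) (rule v anticommute; assumption)+
  then have s: "is_pol_endo n v s"
    unfolding s_def by (rule theI')
  have "\<exists>!d. is_twisted_derivation n s c d"
    by (rule twisted_derivation_ex1[OF s]) (rule c kills; assumption)+
  then have "is_twisted_derivation n s c d"
    unfolding d_def by (rule theI')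
  then show ?thesis
    using s by (simp add: is_twisted_derivation_def is_pol_endo_def pol_x_closed)
qed

lemma demazure_odd_divided_difference:
  assumes i: "i \<in> {1..n-1}"
  shows "odd_divided_difference (Pol n) {1..n} (pol_x n) i (i + 1) (demazure n i)"
proof -
  interpret ring "Pol n" by (rule ring_Pol)
  let ?\<sigma> = "\<lambda>j. if j = i then i + 1 else if j = i + 1 then i else j"
  let ?v = "\<lambda>j. \<ominus>\<^bsub>Pol n\<^esub> pol_x n (?\<sigma> j)"
  let ?c = "\<lambda>j. if j = i \<or> j = i + 1 then \<one>\<^bsub>Pol n\<^esub> else \<zero>\<^bsub>Pol n\<^esub>"
  have ends: "i \<in> {1..n}" "i + 1 \<in> {1..n}" using i by auto
  have x: "pol_x n i \<in> carrier (Pol n)" "pol_x n (i + 1) \<in> carrier (Pol n)"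
    using ends by (auto intro: pol_x_closed)
  have \<sigma>: "?\<sigma> j \<in> {1..n}" if "j \<in> {1..n}" for j
    using that i by auto
  have v: "?v j \<in> carrier (Pol n)" if "j \<in> {1..n}" for j
    using pol_x_closed[OF \<sigma>[OF that]] by (rule a_inv_closed)
  have anticommute: "?v j \<otimes>\<^bsub>Pol n\<^esub> ?v k \<oplus>\<^bsub>Pol n\<^esub> ?v k \<otimes>\<^bsub>Pol n\<^esub> ?v j = \<zero>\<^bsub>Pol n\<^esub>"
    if "j \<in> {1..n}" "k \<in> {1..n}" "j \<noteq> k" for j k
  proof -
    have ne: "?\<sigma> j \<noteq> ?\<sigma> k" using that(3) by simp
    show ?thesis
      using pol_x_anticommute[OF \<sigma>[OF that(1)] \<sigma>[OF that(2)] ne]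
        pol_x_closed[OF \<sigma>[OF that(1)]] pol_x_closed[OF \<sigma>[OF that(2)]]
      by (simp only: l_minus r_minus minus_minus m_closed a_inv_closed)
  qed
  have c: "?c j \<in> carrier (Pol n)" for j
    by simp
  have kills: "(?c j \<otimes>\<^bsub>Pol n\<^esub> pol_x n k \<oplus>\<^bsub>Pol n\<^esub> ?v j \<otimes>\<^bsub>Pol n\<^esub> ?c k) \<oplus>\<^bsub>Pol n\<^esub>
      (?c k \<otimes>\<^bsub>Pol n\<^esub> pol_x n j \<oplus>\<^bsub>Pol n\<^esub> ?v k \<otimes>\<^bsub>Pol n\<^esub> ?c j) = \<zero>\<^bsub>Pol n\<^esub>"
    if "j \<in> {1..n}" "k \<in> {1..n}" "j \<noteq> k" for j k
    using that x pol_x_closed[OF that(1)] pol_x_closed[OF that(2)]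
    by (simp add: r_neg l_neg l_minus)
  have "demazure n i \<in> carrier (End (Pol n)) \<and> demazure n i \<one>\<^bsub>Pol n\<^esub> = \<zero>\<^bsub>Pol n\<^esub> \<and>
    (\<forall>j \<in> {1..n}. \<forall>f \<in> carrier (Pol n). demazure n i (pol_x n j \<otimes>\<^bsub>Pol n\<^esub> f) =
      ?c j \<otimes>\<^bsub>Pol n\<^esub> f \<oplus>\<^bsub>Pol n\<^esub> ?v j \<otimes>\<^bsub>Pol n\<^esub> demazure n i f)"
    unfolding demazure_def s_odd_def
    by (rule The_twisted_derivation) (rule v anticommute c kills; assumption?)+
  then have d: "demazure n i \<in> carrier (End (Pol n))" "demazure n i \<one>\<^bsub>Pol n\<^esub> = \<zero>\<^bsub>Pol n\<^esub>"
    "\<And>j f. \<lbrakk>j \<in> {1..n}; f \<in> carrier (Pol n)\<rbrakk> \<Longrightarrow> demazure n i (pol_x n j \<otimes>\<^bsub>Pol n\<^esub> f) =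
      ?c j \<otimes>\<^bsub>Pol n\<^esub> f \<oplus>\<^bsub>Pol n\<^esub> ?v j \<otimes>\<^bsub>Pol n\<^esub> demazure n i f"
    by blast+
  show ?thesis
    unfolding odd_divided_difference_def
  proof (intro conjI ballI)
    show "demazure n i \<in> carrier (End (Pol n))" "demazure n i \<one>\<^bsub>Pol n\<^esub> = \<zero>\<^bsub>Pol n\<^esub>"
      using d(1,2) by simp_all
    fix f assume f: "f \<in> carrier (Pol n)"
    note df = End_closed[OF d(1) f]
    show "demazure n i (pol_x n i \<otimes>\<^bsub>Pol n\<^esub> f) = f \<ominus>\<^bsub>Pol n\<^esub> pol_x n (i + 1) \<otimes>\<^bsub>Pol n\<^esub> demazure n i f"
      using d(3)[OF ends(1) f] f df x by (simp add: minus_eq l_minus)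
    show "demazure n i (pol_x n (i + 1) \<otimes>\<^bsub>Pol n\<^esub> f) = f \<ominus>\<^bsub>Pol n\<^esub> pol_x n i \<otimes>\<^bsub>Pol n\<^esub> demazure n i f"
      using d(3)[OF ends(2) f] f df x by (simp add: minus_eq l_minus)
    show "demazure n i (pol_x n j \<otimes>\<^bsub>Pol n\<^esub> f) = \<ominus>\<^bsub>Pol n\<^esub> (pol_x n j \<otimes>\<^bsub>Pol n\<^esub> demazure n i f)"
      if "j \<in> {1..n} - {i, i + 1}" for j
      using d(3)[of j f] that f df pol_x_closed[of j n] by (simp add: l_minus)
  qed
qed

text \<open>
  The operator $\partial_n^D$ is the type A operator for the last two members of
  \<open>x\<^sub>1, \<dots>, x\<^sub>n\<^sub>-\<^sub>1, - x\<^sub>n\<close>: both \<open>x\<^sub>n\<^sub>-\<^sub>1\<close> and \<open>- x\<^sub>n\<close> have derivative \<open>1\<close>, and the twist maps each of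
  them to minus the other.
\<close>

lemma demazure_D_odd_divided_difference:
  assumes n: "n \<ge> 2"
  shows "odd_divided_difference (Pol n) {1..n} ((pol_x n)(n := \<ominus>\<^bsub>Pol n\<^esub> pol_x n n)) (n - 1) n
    (demazure_D n)"
proof -
  interpret ring "Pol n" by (rule ring_Pol)
  let ?v = "\<lambda>j. if j = n then pol_x n (n - 1) else if j = n - 1 then pol_x n n
    else \<ominus>\<^bsub>Pol n\<^esub> pol_x n j"
  let ?c = "\<lambda>j. if j = n then \<ominus>\<^bsub>Pol n\<^esub> \<one>\<^bsub>Pol n\<^esub> else if j = n - 1 then \<one>\<^bsub>Pol n\<^esub> else \<zero>\<^bsub>Pol n\<^esub>"
  have ne: "n - Suc 0 \<noteq> n" using n by simp
  have ends: "n - 1 \<in> {1..n}" "n \<in> {1..n}" "n - 1 \<noteq> n" using n by auto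
  note x = pol_x_closed[OF ends(1)] pol_x_closed[OF ends(2)]
  have v: "?v j \<in> carrier (Pol n)" if "j \<in> {1..n}" for j
    using x pol_x_closed[OF that] by simp
  have anticommute: "?v j \<otimes>\<^bsub>Pol n\<^esub> ?v k \<oplus>\<^bsub>Pol n\<^esub> ?v k \<otimes>\<^bsub>Pol n\<^esub> ?v j = \<zero>\<^bsub>Pol n\<^esub>"
    if jk: "j \<in> {1..n}" "k \<in> {1..n}" "j \<noteq> k" for j k
  proof -
    \<comment> \<open>The shape that remains when exactly one of the two images carries a sign.\<close>
    have neg: "\<ominus>\<^bsub>Pol n\<^esub> (a \<otimes>\<^bsub>Pol n\<^esub> b) \<oplus>\<^bsub>Pol n\<^esub> \<ominus>\<^bsub>Pol n\<^esub> (b \<otimes>\<^bsub>Pol n\<^esub> a) = \<zero>\<^bsub>Pol n\<^esub>"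
      if "a \<otimes>\<^bsub>Pol n\<^esub> b \<oplus>\<^bsub>Pol n\<^esub> b \<otimes>\<^bsub>Pol n\<^esub> a = \<zero>\<^bsub>Pol n\<^esub>" "a \<in> carrier (Pol n)" "b \<in> carrier (Pol n)"
      for a b
      using that by (simp flip: minus_add)
    show ?thesis
      using jk x pol_x_closed[OF jk(1)] pol_x_closed[OF jk(2)] ends
        pol_x_anticommute[of j n k] pol_x_anticommute[of "n - 1" n k] pol_x_anticommute[of n n k]
        pol_x_anticommute[of j n "n - 1"] pol_x_anticommute[of j n n]
        pol_x_anticommute[of n n "n - 1"] pol_x_anticommute[of "n - 1" n n]
      by (auto simp add: l_minus r_minus neg)
  qed
  have c: "?c j \<in> carrier (Pol n)" for j
    by simp
  have kills: "(?c j \<otimes>\<^bsub>Pol n\<^esub> pol_x n k \<oplus>\<^bsub>Pol n\<^esub> ?v j \<otimes>\<^bsub>Pol n\<^esub> ?c k) \<oplus>\<^bsub>Pol n\<^esub>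
      (?c k \<otimes>\<^bsub>Pol n\<^esub> pol_x n j \<oplus>\<^bsub>Pol n\<^esub> ?v k \<otimes>\<^bsub>Pol n\<^esub> ?c j) = \<zero>\<^bsub>Pol n\<^esub>"
    if "j \<in> {1..n}" "k \<in> {1..n}" "j \<noteq> k" for j k
    using that x pol_x_closed[OF that(1)] pol_x_closed[OF that(2)]
    by (simp add: l_minus r_minus r_neg l_neg)
  have "demazure_D n \<in> carrier (End (Pol n)) \<and> demazure_D n \<one>\<^bsub>Pol n\<^esub> = \<zero>\<^bsub>Pol n\<^esub> \<and>
    (\<forall>j \<in> {1..n}. \<forall>f \<in> carrier (Pol n). demazure_D n (pol_x n j \<otimes>\<^bsub>Pol n\<^esub> f) =
      ?c j \<otimes>\<^bsub>Pol n\<^esub> f \<oplus>\<^bsub>Pol n\<^esub> ?v j \<otimes>\<^bsub>Pol n\<^esub> demazure_D n f)"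
    unfolding demazure_D_def s_D_def
    by (rule The_twisted_derivation) (rule v anticommute c kills; assumption?)+
  then have d: "demazure_D n \<in> carrier (End (Pol n))" "demazure_D n \<one>\<^bsub>Pol n\<^esub> = \<zero>\<^bsub>Pol n\<^esub>"
    "\<And>j f. \<lbrakk>j \<in> {1..n}; f \<in> carrier (Pol n)\<rbrakk> \<Longrightarrow> demazure_D n (pol_x n j \<otimes>\<^bsub>Pol n\<^esub> f) =
      ?c j \<otimes>\<^bsub>Pol n\<^esub> f \<oplus>\<^bsub>Pol n\<^esub> ?v j \<otimes>\<^bsub>Pol n\<^esub> demazure_D n f"
    by blast+
  show ?thesis
    unfolding odd_divided_difference_def
  proof (intro conjI ballI)
    show "demazure_D n \<in> carrier (End (Pol n))" "demazure_D n \<one>\<^bsub>Pol n\<^esub> = \<zero>\<^bsub>Pol n\<^esub>"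
      using d(1,2) by simp_all
    fix f assume f: "f \<in> carrier (Pol n)"
    note df = End_closed[OF d(1) f]
    let ?y = "(pol_x n)(n := \<ominus>\<^bsub>Pol n\<^esub> pol_x n n)"
    show "demazure_D n (?y (n - 1) \<otimes>\<^bsub>Pol n\<^esub> f) = f \<ominus>\<^bsub>Pol n\<^esub> ?y n \<otimes>\<^bsub>Pol n\<^esub> demazure_D n f"
      using d(3)[OF ends(1) f] f df x ne by (simp add: minus_eq l_minus)
    show "demazure_D n (?y n \<otimes>\<^bsub>Pol n\<^esub> f) = f \<ominus>\<^bsub>Pol n\<^esub> ?y (n - 1) \<otimes>\<^bsub>Pol n\<^esub> demazure_D n f"
      using d(3)[OF ends(2) f] f df x ne by (simp add: minus_eq l_minus minus_add End_uminus[OF d(1)])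
    show "demazure_D n (?y j \<otimes>\<^bsub>Pol n\<^esub> f) = \<ominus>\<^bsub>Pol n\<^esub> (?y j \<otimes>\<^bsub>Pol n\<^esub> demazure_D n f)"
      if "j \<in> {1..n} - {n - 1, n}" for j
      using d(3)[of j f] that f df pol_x_closed[of j n] by (simp add: l_minus)
  qed
qed

lemma (in ring) End_minus_apply:
  assumes "S \<in> carrier (End R)" "T \<in> carrier (End R)" "f \<in> carrier R"
  shows "(S \<ominus>\<^bsub>End R\<^esub> T) f = S f \<ominus> T f"
proof -
  have "S \<ominus>\<^bsub>End R\<^esub> T \<in> carrier (End R)"
    using ring_End assms by (simp add: abelian_group.minus_closed ring.is_abelian_group)
  moreover have "(S \<ominus>\<^bsub>End R\<^esub> T) \<oplus>\<^bsub>End R\<^esub> T = S"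
    using ring_End assms
    by (simp add: a_minus_def abelian_group.l_neg abelian_group.a_inv_closed
        abelian_monoid.a_assoc abelian_monoid.r_zero abelian_group.axioms(1) ring.is_abelian_group)
  then have "(S \<ominus>\<^bsub>End R\<^esub> T) f \<oplus> T f = S f"
    using End_apply(2)[OF assms(3), of "S \<ominus>\<^bsub>End R\<^esub> T" T] by simp
  ultimately show ?thesis
    using assms End_closed[of _ R f] by (metis a_assoc a_inv_closed minus_eq r_neg r_zero)
qed

section \<open>The representation\<close>

definition nh_operator :: "nat \<Rightarrow> nh_gen \<Rightarrow> nat ncpoly set \<Rightarrow> nat ncpoly set" where
  "nh_operator n g = (case g of
     X i \<Rightarrow> left_mult (Pol n) (pol_x n i) | Del i \<Rightarrow> demazure n i | DelD \<Rightarrow> demazure_D n)"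

text \<open>
  Evaluated at a skew polynomial, the relations among the \<open>x\<close> hold since the variables anticommute,
  the mixed relations are instances of the rules for divided differences, and the remaining ones are
  relations among divided differences. Those between
  $\partial_n^D$ and $\partial_i^-$ with \<open>i \<le> n - 2\<close> are read in the family \<open>x\<^sub>1, \<dots>, x\<^sub>n\<^sub>-\<^sub>1, - x\<^sub>n\<close>, in
  which both operators are of type A.
\<close>

lemma nh_operator_kills_relations:
  assumes n: "n \<ge> 2" and h: "h \<in> ring_hom (free_algebra (NHD_gens n)) (End (Pol n))"
    and h_gen: "\<forall>g \<in> NHD_gens n. h (gen g) = nh_operator n g"
    and r: "r \<in> NHD_rels n"
  shows "h r = \<zero>\<^bsub>End (Pol n)\<^esub>"
proof -
  interpret x: generated_ring "Pol n" "{1..n}" "pol_x n" by (rule generated_ring_Pol)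
  let ?y = "(pol_x n)(n := \<ominus>\<^bsub>Pol n\<^esub> pol_x n n)"
  have n_mem: "n \<in> {1..n}" using n by simp
  interpret y: generated_ring "Pol n" "{1..n}" ?y
    by (rule x.generated_ring_negate[OF n_mem])
  let ?F = "carrier (free_algebra (NHD_gens n))"
  let ?P = "carrier (Pol n)"
  have gens: "X i \<in> NHD_gens n" if "i \<in> {1..n}" for i
    using that by (simp add: NHD_gens_def)
  have gens': "Del i \<in> NHD_gens n" if "i \<in> {1..n-1}" for i
    using that by (simp add: NHD_gens_def)
  have gens'': "DelD \<in> NHD_gens n"
    by (simp add: NHD_gens_def)
  note mem = free_algebra_closed gens gens' gens''
  have h_mult: "h (p * q) f = h p (h q f)" and h_add: "h (p + q) f = h p f \<oplus>\<^bsub>Pol n\<^esub> h q f"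
    and h_diff: "h (p - q) f = h p f \<ominus>\<^bsub>Pol n\<^esub> h q f"
    if "p \<in> ?F" "q \<in> ?F" "f \<in> ?P" for p q f
    using that ring_hom_mult[OF h that(1,2)] ring_hom_add[OF h that(1,2)]
      ring_hom_free_algebra_diff[OF h x.ring_End that(1,2)] ring_hom_closed[OF h]
    by (simp_all add: End_apply x.End_minus_apply)
  have h_one: "h 1 f = f" if "f \<in> ?P" for f
    using ring_hom_one[OF h] that by (simp add: End_apply)
  have h_x: "h (fx i) f = pol_x n i \<otimes>\<^bsub>Pol n\<^esub> f" if "i \<in> {1..n}" "f \<in> ?P" for i f
    using bspec[OF h_gen gens] that by (simp add: nh_operator_def left_mult_def)
  have h_d: "h (fd i) = demazure n i" if "i \<in> {1..n-1}" for i
    using bspec[OF h_gen gens'[OF that]] by (simp add: nh_operator_def)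
  have h_D: "h fD = demazure_D n"
    using bspec[OF h_gen gens''] by (simp add: nh_operator_def)
  note h_rules = h_mult h_add h_diff h_one h_x h_d h_D mem

  have d: "x.odd_dd i (i + 1) (demazure n i)" if "i \<in> {1..n-1}" for i
    using that by (rule demazure_odd_divided_difference)
  \<comment> \<open>Here \<open>n\<close> lies outside the pair of the operator, so the sign of \<open>x\<^sub>n\<close> is immaterial.\<close>
  have d_y: "y.odd_dd i (i + 1) (demazure n i)" if "1 \<le> i" "i + 2 \<le> n" for i
    using that by (intro x.odd_dd_negate d n_mem) auto
  have D: "y.odd_dd (n - 1) n (demazure_D n)"
    using n by (rule demazure_D_odd_divided_difference)
  have x_mem: "pol_x n i \<in> ?P" if "i \<in> {1..n}" for i
    using that by (rule pol_x_closed)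
  have d_mem: "demazure n i f \<in> ?P" if "i \<in> {1..n-1}" "f \<in> ?P" for i f
    using x.odd_dd_rules(1)[OF d] that by blast
  have D_mem: "demazure_D n f \<in> ?P" if "f \<in> ?P" for f
    using y.odd_dd_rules(1)[OF D] that by blast
  note closed = x_mem d_mem D_mem

  have ends: "n - 1 \<in> {1..n}" "n \<in> {1..n}" "n - 1 \<in> {1..n-1}" using n by auto
  have ne: "n - Suc 0 \<noteq> n" using n by simp
  note x_n = x_mem[OF ends(1)] x_mem[OF ends(2)]

  have "h r f = \<zero>\<^bsub>Pol n\<^esub>" if f: "f \<in> ?P" for f
    using r
  proof cases
    case (x_x i j)
    have "pol_x n i \<otimes>\<^bsub>Pol n\<^esub> (pol_x n j \<otimes>\<^bsub>Pol n\<^esub> f) \<oplus>\<^bsub>Pol n\<^esub>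
        pol_x n j \<otimes>\<^bsub>Pol n\<^esub> (pol_x n i \<otimes>\<^bsub>Pol n\<^esub> f) =
      (pol_x n i \<otimes>\<^bsub>Pol n\<^esub> pol_x n j \<oplus>\<^bsub>Pol n\<^esub> pol_x n j \<otimes>\<^bsub>Pol n\<^esub> pol_x n i) \<otimes>\<^bsub>Pol n\<^esub> f"
      using x_mem[OF x_x(2)] x_mem[OF x_x(3)] f by (simp add: x.l_distr x.m_assoc)
    also have "\<dots> = \<zero>\<^bsub>Pol n\<^esub>"
      using pol_x_anticommute[OF x_x(2-4)] f by simp
    finally show ?thesis
      using x_x x_mem f by (simp add: h_rules)
  next
    case (d_sq i)
    have "demazure n i (demazure n i f) = \<zero>\<^bsub>Pol n\<^esub>"
      using d_sq(2) by (intro x.odd_dd_square[OF d] f) auto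
    then show ?thesis using d_sq f by (simp add: h_rules closed)
  next
    case (d_braid i)
    have "demazure n i (demazure n (i + 1) (demazure n i f)) =
        demazure n (i + 1) (demazure n i (demazure n (i + 1) f))"
      using d_braid(2,3) by (intro x.odd_dd_braid[OF d d] f) auto
    then show ?thesis using d_braid f by (simp add: h_rules closed x.minus_eq x.r_neg)
  next
    case (d_d i j)
    have "demazure n i (demazure n j f) = \<ominus>\<^bsub>Pol n\<^esub> demazure n j (demazure n i f)"
      using d_d(2-4) by (intro x.odd_dd_far[OF d d] f) auto
    then show ?thesis using d_d f by (simp add: h_rules closed x.l_neg)
  next
    case (x_d i)
    have i: "i \<in> {1..n}" "i + 1 \<in> {1..n}" using x_d(2) by auto
    show ?thesis
      using x.odd_dd_rules(7)[OF d[OF x_d(2)] f] x_mem[OF i(1)] x_mem[OF i(2)] d_mem[OF x_d(2) f] f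
        x_d(2) i
      by (simp add: x_d(1) h_rules x.minus_eq x.a_ac x.r_neg x.r_neg1 x.r_neg2)
  next
    case (d_x i)
    have i: "i \<in> {1..n}" "i + 1 \<in> {1..n}" using d_x(2) by auto
    show ?thesis
      using x.odd_dd_rules(6)[OF d[OF d_x(2)] f] x_mem[OF i(1)] x_mem[OF i(2)] d_mem[OF d_x(2) f] f
        d_x(2) i
      by (simp add: d_x(1) h_rules x.minus_eq x.a_ac x.r_neg x.r_neg1 x.r_neg2)
  next
    case (d_x_far i j)
    show ?thesis
      using x.odd_dd_rules(8)[OF d[OF d_x_far(2)] f d_x_far(3-5)] x_mem[OF d_x_far(3)]
        d_mem[OF d_x_far(2) f] f d_x_far(2,3)
      by (simp add: d_x_far(1) h_rules x.l_neg)
  next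
    case D_sq
    have "demazure_D n (demazure_D n f) = \<zero>\<^bsub>Pol n\<^esub>"
      using n by (intro y.odd_dd_square[OF D] f) auto
    then show ?thesis using D_sq f by (simp add: h_rules closed)
  next
    case D_braid
    have i: "n - 2 \<in> {1..n-1}" "n - 2 + 1 = n - 1" using D_braid(2) by auto
    have "y.odd_dd (n - 2) (n - 1) (demazure n (n - 2))"
      using d_y[of "n - 2"] D_braid(2) i(2) by simp
    then have "demazure n (n - 2) (demazure_D n (demazure n (n - 2) f)) =
        demazure_D n (demazure n (n - 2) (demazure_D n f))"
      using D_braid(2) by (intro y.odd_dd_braid[OF _ D] f) auto
    then show ?thesis
      using D_braid i(1) f by (simp add: h_rules closed x.minus_eq x.r_neg)
  next
    case (D_d i)
    have i: "i \<in> {1..n-1}" using D_d(2,3) by auto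
    have "demazure_D n (demazure n i f) = \<ominus>\<^bsub>Pol n\<^esub> demazure n i (demazure_D n f)"
      using D_d(2,3) by (intro y.odd_dd_far[OF D d_y] f) auto
    then show ?thesis using D_d(1) i f by (simp add: h_rules closed x.l_neg)
  next
    case D_d_last
    have i: "n - 1 \<in> {1..n-1}" "n - 1 + 1 = n" using n by auto
    have "x.odd_dd (n - 1) n (demazure n (n - 1))"
      using d[OF i(1)] i(2) by simp
    then have "demazure_D n (demazure n (n - 1) f) = demazure n (n - 1) (demazure_D n f)"
      using n by (intro x.odd_dd_commute_opposite[OF _ D] f) auto
    then show ?thesis using D_d_last i f by (simp add: h_rules closed x.minus_eq x.r_neg)
  next
    case x_D
    have "demazure_D n (\<ominus>\<^bsub>Pol n\<^esub> (pol_x n n \<otimes>\<^bsub>Pol n\<^esub> f)) =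
        f \<ominus>\<^bsub>Pol n\<^esub> pol_x n (n - 1) \<otimes>\<^bsub>Pol n\<^esub> demazure_D n f"
      using y.odd_dd_rules(7)[OF D f] ne x_n f by (simp add: x.l_minus)
    then have "\<ominus>\<^bsub>Pol n\<^esub> demazure_D n (pol_x n n \<otimes>\<^bsub>Pol n\<^esub> f) =
        f \<ominus>\<^bsub>Pol n\<^esub> pol_x n (n - 1) \<otimes>\<^bsub>Pol n\<^esub> demazure_D n f"
      using y.odd_dd_rules(5)[OF D] x_n f by simp
    then show ?thesis
      using x_n D_mem[OF f] f ends
      by (simp add: x_D h_rules D_mem x.minus_eq x.a_ac x.r_neg x.r_neg1 x.r_neg2)
  next
    case D_x
    have "demazure_D n (pol_x n (n - 1) \<otimes>\<^bsub>Pol n\<^esub> f) =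
        f \<oplus>\<^bsub>Pol n\<^esub> pol_x n n \<otimes>\<^bsub>Pol n\<^esub> demazure_D n f"
      using y.odd_dd_rules(6)[OF D f] ne x_n D_mem[OF f] f by (simp add: x.l_minus x.minus_eq)
    then show ?thesis
      using x_n D_mem[OF f] f ends
      by (simp add: D_x h_rules D_mem x.minus_eq x.a_ac x.r_neg x.r_neg1 x.r_neg2)
  next
    case (D_x_far i)
    have i: "i \<in> {1..n}" "i \<noteq> n - 1" "i \<noteq> n" using D_x_far(2,3) by auto
    show ?thesis
      using y.odd_dd_rules(8)[OF D f i] i x_mem[OF i(1)] D_mem[OF f] f
      by (simp add: D_x_far(1) h_rules x.l_neg)
  qed
  then show ?thesis
    using ring_hom_closed[OF h] NHD_rels_closed[OF n] r
    by (intro End_eqI[of _ "Pol n"] x.End_ops_closed) (auto simp: End_apply)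
qed

theorem theorem2p10:
  fixes n :: nat
  assumes "n \<ge> 2"
  shows "\<exists>\<rho> \<in> ring_hom (NHD n) (End (Pol n)).
    (\<forall>i \<in> {1..n}. \<rho> (nhd_x n i) = left_mult (Pol n) (pol_x n i)) \<and>
    (\<forall>i \<in> {1..n-1}. \<rho> (nhd_d n i) = demazure n i) \<and>
    \<rho> (nhd_D n) = demazure_D n"
proof -
  have End: "ring (End (Pol n))"
    by (rule ring.ring_End[OF ring_Pol])
  have "nh_operator n g \<in> carrier (End (Pol n))" if "g \<in> NHD_gens n" for g
    using that ring.left_mult_End[OF ring_Pol pol_x_closed]
      demazure_odd_divided_difference demazure_D_odd_divided_difference[OF assms]
    by (auto simp: NHD_gens_def nh_operator_def odd_divided_difference_def)
  then have "\<exists>h \<in> ring_hom (free_algebra (NHD_gens n)) (End (Pol n)).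
      \<forall>g \<in> NHD_gens n. h (gen g) = nh_operator n g"
    by (rule ring.free_algebra_universal[OF End])
  then obtain h where h: "h \<in> ring_hom (free_algebra (NHD_gens n)) (End (Pol n))"
    and h_gen: "\<forall>g \<in> NHD_gens n. h (gen g) = nh_operator n g" ..
  have "\<exists>\<rho> \<in> ring_hom (NHD n) (End (Pol n)).
      \<forall>g \<in> NHD_gens n. \<rho> (presented_gen (NHD_gens n) (NHD_rels n) g) = h (gen g)"
    unfolding NHD_def
    by (rule presented_algebra_universal[OF End h NHD_rels_closed[OF assms]])
      (rule nh_operator_kills_relations[OF assms h h_gen])
  then obtain \<rho> where \<rho>: "\<rho> \<in> ring_hom (NHD n) (End (Pol n))"
    and \<rho>_gen: "\<forall>g \<in> NHD_gens n. \<rho> (presented_gen (NHD_gens n) (NHD_rels n) g) = h (gen g)" ..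
  have "\<rho> (presented_gen (NHD_gens n) (NHD_rels n) g) = nh_operator n g" if "g \<in> NHD_gens n" for g
    using \<rho>_gen h_gen that by simp
  from this[of "X _"] this[of "Del _"] this[of DelD] show ?thesis
    by (intro bexI[OF _ \<rho>]) (simp add: nhd_x_def nhd_d_def nhd_D_def NHD_gens_def nh_operator_def)
qed

end
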